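(* Let $n\geq 1$, let $M_n$ be the monoid defined below and set $\Delta:=\rho_n^{n+1}\in M_n$. Then $(M_n,\Delta)$ is a Garside monoid. Consequently $M_n$ embeds in its group of fractions $G(M_n)$, which is the group defined by the same presentation as $M_n$; this group $G(M_n)$ is isomorphic to the $(n,n+1)$-torus knot group $G(n,n+1)=\langle x,y \mid x^n=y^{n+1}\rangle$.
   Context: For $n\geq 1$, $M_n$ denotes the monoid with generators $\rho_1,\dots,\rho_n$ and relations $\rho_1\rho_n\rho_i=\rho_{i+1}\rho_n$ for $1\leq i\leq n-1$. In a monoid $M$, $a$ left-divides $c$ (and $c$ is a right-multiple of $a$) if $c=ab$ for some $b\in M$; similarly for right-divisibility/left-multiples. Lcms and gcds are taken with respect to these divisibility relations. A Garside monoid is a pair $(M,\Delta)$ with $M$ a monoid and $\Delta\in M$ such that: (1) $M$ is left- and right-cancellative; (2) divisibility in $M$ is Noetherian, i.e. there is $\lambda:M\to\mathbb{Z}_{\geq 0}$ with $\lambda(ab)\geq\lambda(a)+\lambda(b)$ for all $a,b$ and $\lambda(a)\neq 0$ for $a\neq 1$; (3) any two elements of $M$ admit a left-lcm, a right-lcm, a left-gcd and a right-gcd; (4) the left-divisors and the right-divisors of $\Delta$ coincide and generate $M$; (5) the set of divisors of $\Delta$ is finite. *)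

theory Defs
  imports "HOL-Algebra.Group"
begin

definition ldvd :: "('a, 'b) monoid_scheme \<Rightarrow> 'a \<Rightarrow> 'a \<Rightarrow> bool" where
  "ldvd M a c \<longleftrightarrow> (\<exists>b\<in>carrier M. c = a \<otimes>\<^bsub>M\<^esub> b)"

definition rdvd :: "('a, 'b) monoid_scheme \<Rightarrow> 'a \<Rightarrow> 'a \<Rightarrow> bool" where
  "rdvd M a c \<longleftrightarrow> (\<exists>b\<in>carrier M. c = b \<otimes>\<^bsub>M\<^esub> a)"

definition is_lcm_wrt :: "('a, 'b) monoid_scheme \<Rightarrow> ('a \<Rightarrow> 'a \<Rightarrow> bool) \<Rightarrow> 'a \<Rightarrow> 'a \<Rightarrow> 'a \<Rightarrow> bool" where
  "is_lcm_wrt M D a b c \<longleftrightarrow> c \<in> carrier M \<and> D a c \<and> D b c \<and>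
     (\<forall>d\<in>carrier M. D a d \<and> D b d \<longrightarrow> D c d)"

definition is_gcd_wrt :: "('a, 'b) monoid_scheme \<Rightarrow> ('a \<Rightarrow> 'a \<Rightarrow> bool) \<Rightarrow> 'a \<Rightarrow> 'a \<Rightarrow> 'a \<Rightarrow> bool" where
  "is_gcd_wrt M D a b c \<longleftrightarrow> c \<in> carrier M \<and> D c a \<and> D c b \<and>
     (\<forall>d\<in>carrier M. D d a \<and> D d b \<longrightarrow> D d c)"

definition garside_monoid :: "('a, 'b) monoid_scheme \<Rightarrow> 'a \<Rightarrow> bool" where
  "garside_monoid M \<Delta> \<longleftrightarrow>
     monoid M \<and> \<Delta> \<in> carrier M \<and>
     \<comment> \<open>(1) left- and right-cancellative\<close>
     (\<forall>a\<in>carrier M. \<forall>b\<in>carrier M. \<forall>c\<in>carrier M.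
        (a \<otimes>\<^bsub>M\<^esub> b = a \<otimes>\<^bsub>M\<^esub> c \<longrightarrow> b = c) \<and>
        (b \<otimes>\<^bsub>M\<^esub> a = c \<otimes>\<^bsub>M\<^esub> a \<longrightarrow> b = c)) \<and>
     \<comment> \<open>(2) Noetherian divisibility\<close>
     (\<exists>len::'a \<Rightarrow> nat.
        (\<forall>a\<in>carrier M. \<forall>b\<in>carrier M. len (a \<otimes>\<^bsub>M\<^esub> b) \<ge> len a + len b) \<and>
        (\<forall>a\<in>carrier M. a \<noteq> \<one>\<^bsub>M\<^esub> \<longrightarrow> len a \<noteq> 0)) \<and>
     \<comment> \<open>(3) lcms and gcds for both divisibility relations\<close>
     (\<forall>a\<in>carrier M. \<forall>b\<in>carrier M.
        (\<exists>c. is_lcm_wrt M (ldvd M) a b c) \<and> (\<exists>c. is_lcm_wrt M (rdvd M) a b c) \<and>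
        (\<exists>c. is_gcd_wrt M (ldvd M) a b c) \<and> (\<exists>c. is_gcd_wrt M (rdvd M) a b c)) \<and>
     \<comment> \<open>(4) left divisors = right divisors of Delta, and they generate M\<close>
     {a\<in>carrier M. ldvd M a \<Delta>} = {a\<in>carrier M. rdvd M a \<Delta>} \<and>
     (\<forall>x\<in>carrier M. \<exists>xs. set xs \<subseteq> {a\<in>carrier M. ldvd M a \<Delta>} \<and>
        x = foldr (\<lambda>a b. a \<otimes>\<^bsub>M\<^esub> b) xs \<one>\<^bsub>M\<^esub>) \<and>
     \<comment> \<open>(5) finitely many divisors\<close>
     finite {a\<in>carrier M. ldvd M a \<Delta>}"

inductive mstep :: "('g list \<times> 'g list) set \<Rightarrow> 'g list \<Rightarrow> 'g list \<Rightarrow> bool" for R where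
  "(p, q) \<in> R \<Longrightarrow> mstep R (u @ p @ v) (u @ q @ v)"

definition mclass :: "'g set \<Rightarrow> ('g list \<times> 'g list) set \<Rightarrow> 'g list \<Rightarrow> 'g list set" where
  "mclass A R w = {w'. w' \<in> lists A \<and> equivclp (mstep R) w w'}"

definition pres_monoid :: "'g set \<Rightarrow> ('g list \<times> 'g list) set \<Rightarrow> 'g list set monoid" where
  "pres_monoid A R = \<lparr> carrier = mclass A R ` lists A,
     mult = (\<lambda>X Y. \<Union>{mclass A R (x @ y) |x y. x \<in> X \<and> y \<in> Y}),
     one = mclass A R [] \<rparr>"

text \<open>Group words: letters (g, True) = g, (g, False) = g inverse.\<close>

definition pos_word :: "'g list \<Rightarrow> ('g \<times> bool) list" where
  "pos_word w = map (\<lambda>g. (g, True)) w"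

inductive gstep :: "('g list \<times> 'g list) set \<Rightarrow> ('g \<times> bool) list \<Rightarrow> ('g \<times> bool) list \<Rightarrow> bool"
  for R where
  cancel: "gstep R (u @ [(x, b), (x, \<not> b)] @ v) (u @ v)"
| rel: "(p, q) \<in> R \<Longrightarrow> gstep R (u @ pos_word p @ v) (u @ pos_word q @ v)"

definition gclass :: "'g set \<Rightarrow> ('g list \<times> 'g list) set \<Rightarrow> ('g \<times> bool) list \<Rightarrow> ('g \<times> bool) list set" where
  "gclass A R w = {w'. w' \<in> lists (A \<times> UNIV) \<and> equivclp (gstep R) w w'}"

definition pres_group :: "'g set \<Rightarrow> ('g list \<times> 'g list) set \<Rightarrow> ('g \<times> bool) list set monoid" where
  "pres_group A R = \<lparr> carrier = gclass A R ` lists (A \<times> UNIV),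
     mult = (\<lambda>X Y. \<Union>{gclass A R (x @ y) |x y. x \<in> X \<and> y \<in> Y}),
     one = gclass A R [] \<rparr>"

definition canon :: "'g set \<Rightarrow> ('g list \<times> 'g list) set \<Rightarrow> 'g list set \<Rightarrow> ('g \<times> bool) list set" where
  "canon A R X = \<Union>{gclass A R (pos_word w) |w. w \<in> X}"

text \<open>Generators rho_1..rho_n are the numbers 1..n; relations
  rho_1 rho_n rho_i = rho_(i+1) rho_n for 1 <= i <= n-1.\<close>
definition Mn_rels :: "nat \<Rightarrow> (nat list \<times> nat list) set" where
  "Mn_rels n = {([1, n, i], [Suc i, n]) |i. 1 \<le> i \<and> i \<le> n - 1}"

definition Mn :: "nat \<Rightarrow> nat list set monoid" where
  "Mn n = pres_monoid {1..n} (Mn_rels n)"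

definition Gn :: "nat \<Rightarrow> (nat \<times> bool) list set monoid" where
  "Gn n = pres_group {1..n} (Mn_rels n)"

definition Delta_n :: "nat \<Rightarrow> nat list set" where
  "Delta_n n = mclass {1..n} (Mn_rels n) (replicate (n + 1) n)"

text \<open>Torus knot group G(p,q) = < x, y | x^p = y^q >, with x = 0, y = 1.\<close>
definition torus_group :: "nat \<Rightarrow> nat \<Rightarrow> (nat \<times> bool) list set monoid" where
  "torus_group p q = pres_group {0, 1} {(replicate p 0, replicate q 1)}"

end

theory Submission
  imports Defs
begin

text \<open>
  In the torus knot group put \<open>\<rho>\<^sub>i = x\<^sup>i y\<^sup>-\<^sup>i\<close>, so that \<open>y = \<rho>\<^sub>n\<close>, \<open>x = \<rho>\<^sub>1\<rho>\<^sub>n\<close>, and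
  \<open>\<Delta> = x\<^sup>n = y\<^sup>n\<^sup>+\<^sup>1\<close> is central. Every group element has a normal form \<open>\<Delta>\<^sup>m\<close> times an
  alternating product of powers of x (exponents in \<open>{1..n-1}\<close>) and of y (exponents in \<open>{1..n}\<close>).
  Such an element is a product of \<open>\<rho>\<close>'s iff m plus the number of adjacent pairs
  \<open>x\<^sup>a y\<^sup>b\<close> with \<open>a + b \<ge> n + 1\<close> is nonnegative. This criterion shows that for \<open>i < j\<close> an element
  of the submonoid that is left divisible there by \<open>\<rho>\<^sub>i\<close> and \<open>\<rho>\<^sub>j\<close> is left divisible by
  \<open>\<rho>\<^sub>j \<rho>\<^sub>n\<^sup>i = \<rho>\<^sub>i \<rho>\<^sub>n\<^sup>i \<rho>\<^sub>j\<^sub>-\<^sub>i\<close>, an identity that already holds in the presented monoid.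
  By induction on the weight \<open>\<rho>\<^sub>i \<mapsto> i\<close> this gives the injectivity of the presented monoid into the
  group, hence cancellation, and lcms of pairs of atoms. In a cancellative weighted monoid with
  common multiples, lcms of atoms yield all lcms for left divisibility; the remaining lcms and gcds
  follow from extremality of the weight and from the duality \<open>a \<mapsto> a\<^sup>-\<^sup>1\<Delta>\<^sup>k\<close>.
\<close>

section \<open>Monoids and groups presented by words\<close>

lemma equivclp_lift:
  assumes "equivclp r a b" and "\<And>a b. r a b \<Longrightarrow> equivclp r' (f a) (f b)"
  shows "equivclp r' (f a) (f b)"
  using assms(1)
proof (induction rule: equivclp_induct)
  case base
  show ?case by simp
next
  case (step y z)
  from step(2) have "equivclp r' (f y) (f z)"
    using assms(2) equivclp_sym by metis
  with step(3) show ?case by (rule equivclp_trans)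
qed

lemma equivclp_invariant:
  assumes "equivclp r a b" and "\<And>a b. r a b \<Longrightarrow> f a = f b"
  shows "f a = f b"
  using assms(1) by (induction rule: equivclp_induct) (auto dest: assms(2))

text \<open>Monoid words and signed group words are two instances of one construction, the quotient
  of words by a congruence. The congruence lives on all lists, so a chain of steps between two words
  over \<open>A\<close> may pass through letters outside \<open>A\<close>.\<close>

locale word_congruence =
  fixes A :: "'g set" and E :: "'g list \<Rightarrow> 'g list \<Rightarrow> bool"
  assumes E_refl: "E u u"
    and E_sym: "E u v \<Longrightarrow> E v u"
    and E_trans: "E u v \<Longrightarrow> E v w \<Longrightarrow> E u w"
    and E_context: "E u v \<Longrightarrow> E (p @ u @ q) (p @ v @ q)"
begin

definition cls :: "'g list \<Rightarrow> 'g list set" where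
  "cls w = {w'. w' \<in> lists A \<and> E w w'}"

definition quot :: "'g list set monoid" where
  "quot = \<lparr> carrier = cls ` lists A,
     mult = (\<lambda>X Y. \<Union>{cls (x @ y) |x y. x \<in> X \<and> y \<in> Y}),
     one = cls [] \<rparr>"

lemma E_append: "E u u' \<Longrightarrow> E v v' \<Longrightarrow> E (u @ v) (u' @ v')"
  using E_context[of u u' "[]" v] E_context[of v v' u' "[]"] E_trans by auto

lemma cls_eq_iff: "v \<in> lists A \<Longrightarrow> cls u = cls v \<longleftrightarrow> E u v"
  unfolding cls_def using E_refl E_sym E_trans by blast

text \<open>Since \<open>E\<close> is a congruence, all classes in the union that defines the
  product coincide, and the union is over a singleton.\<close>

lemma cls_mult:
  assumes "u \<in> lists A" and "v \<in> lists A"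
  shows "cls u \<otimes>\<^bsub>quot\<^esub> cls v = cls (u @ v)"
proof -
  have "cls (x @ y) = cls (u @ v)" if "x \<in> cls u" "y \<in> cls v" for x y
  proof -
    have "E (u @ v) (x @ y)"
      using that by (auto simp: cls_def intro: E_append)
    then show ?thesis
      using that assms by (subst cls_eq_iff) (auto simp: cls_def intro: E_sym)
  qed
  moreover have "u \<in> cls u" "v \<in> cls v"
    using assms E_refl by (auto simp: cls_def)
  ultimately have "{cls (x @ y) |x y. x \<in> cls u \<and> y \<in> cls v} = {cls (u @ v)}"
    by blast
  then show ?thesis by (simp add: quot_def)
qed

lemma carrier_quot: "carrier quot = cls ` lists A"
  and one_quot: "\<one>\<^bsub>quot\<^esub> = cls []"
  by (simp_all add: quot_def)

lemma monoid_quot: "monoid quot"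
  by (rule monoidI)
    (auto simp: carrier_quot one_quot cls_mult del: in_listsD)

end

lemma mstep_context: "mstep R u v \<Longrightarrow> mstep R (p @ u @ q) (p @ v @ q)"
proof (induction rule: mstep.induct)
  case (1 a b u v)
  then show ?case using mstep.intros[of a b R "p @ u" "v @ q"] by simp
qed

lemma gstep_context: "gstep R u v \<Longrightarrow> gstep R (p @ u @ q) (p @ v @ q)"
proof (induction rule: gstep.induct)
  case (cancel u x b v)
  then show ?case using gstep.cancel[of R "p @ u" x b "v @ q"] by simp
next
  case (rel a b u v)
  then show ?case using gstep.rel[of a b R "p @ u" "v @ q"] by simp
qed

lemma word_congruence_mstep: "word_congruence (equivclp (mstep R))"
  by unfold_locales
    (auto intro: equivclp_sym equivclp_trans mstep_context
      elim!: equivclp_lift[where f = "\<lambda>w. _ @ w @ _"])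

lemma word_congruence_gstep: "word_congruence (equivclp (gstep R))"
  by unfold_locales
    (auto intro: equivclp_sym equivclp_trans gstep_context
      elim!: equivclp_lift[where f = "\<lambda>w. _ @ w @ _"])

context
  fixes A :: "'g set" and R :: "('g list \<times> 'g list) set"
begin

interpretation M: word_congruence A "equivclp (mstep R)"
  rewrites "word_congruence.cls A (equivclp (mstep R)) = mclass A R"
    and "word_congruence.quot A (equivclp (mstep R)) = pres_monoid A R"
proof -
  interpret word_congruence A "equivclp (mstep R)"
    by (rule word_congruence_mstep)
  show "word_congruence (equivclp (mstep R))"
    by (rule word_congruence_mstep)
  show 1: "cls = mclass A R"
    by (simp add: fun_eq_iff cls_def mclass_def)
  show "quot = pres_monoid A R"
    by (simp add: quot_def pres_monoid_def 1)
qed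

interpretation G: word_congruence "A \<times> (UNIV :: bool set)" "equivclp (gstep R)"
  rewrites "word_congruence.cls (A \<times> UNIV) (equivclp (gstep R)) = gclass A R"
    and "word_congruence.quot (A \<times> UNIV) (equivclp (gstep R)) = pres_group A R"
proof -
  interpret word_congruence "A \<times> UNIV" "equivclp (gstep R)"
    by (rule word_congruence_gstep)
  show "word_congruence (equivclp (gstep R))"
    by (rule word_congruence_gstep)
  show 1: "cls = gclass A R"
    by (simp add: fun_eq_iff cls_def gclass_def)
  show "quot = pres_group A R"
    by (simp add: quot_def pres_group_def 1)
qed

lemmas mclass_eq_iff = M.cls_eq_iff
  and mclass_mult = M.cls_mult
  and carrier_pres_monoid = M.carrier_quot
  and one_pres_monoid = M.one_quot
  and monoid_pres_monoid = M.monoid_quot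
  and meq_append = M.E_append

lemmas gclass_eq_iff = G.cls_eq_iff
  and gclass_mult = G.cls_mult
  and carrier_pres_group = G.carrier_quot
  and one_pres_group = G.one_quot
  and monoid_pres_group = G.monoid_quot

end

section \<open>Inverses in presented groups and the canonical map from the monoid\<close>

definition inverse_word :: "('g \<times> bool) list \<Rightarrow> ('g \<times> bool) list" where
  "inverse_word w = rev (map (\<lambda>(g, b). (g, \<not> b)) w)"

lemma inverse_word_simps [simp]:
  "inverse_word [] = []"
  "inverse_word ((g, b) # w) = inverse_word w @ [(g, \<not> b)]"
  by (simp_all add: inverse_word_def)

lemma inverse_word_in_lists:
  "w \<in> lists (A \<times> UNIV) \<Longrightarrow> inverse_word w \<in> lists (A \<times> UNIV)"
  by (induction w) auto

lemma inverse_word_left: "equivclp (gstep R) (inverse_word w @ w) []"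
proof (induction w)
  case Nil
  show ?case by simp
next
  case (Cons l w)
  obtain g b where l: "l = (g, b)" by force
  \<comment> \<open>The letter and its inverse meet in the middle of the word; the double negation
    matches the shape of \<open>gstep.cancel\<close>.\<close>
  have "gstep R (inverse_word w @ [(g, \<not> b), (g, \<not> \<not> b)] @ w) (inverse_word w @ w)"
    by (rule gstep.cancel)
  then have "equivclp (gstep R) (inverse_word (l # w) @ l # w) (inverse_word w @ w)"
    by (simp add: l r_into_equivclp)
  then show ?case using Cons by (rule equivclp_trans)
qed

lemma group_pres_group: "group (pres_group A R)"
proof (rule groupI)
  fix x assume "x \<in> carrier (pres_group A R)"
  then obtain w where w: "w \<in> lists (A \<times> UNIV)" "x = gclass A R w"
    by (auto simp: carrier_pres_group)
  then have "gclass A R (inverse_word w) \<otimes>\<^bsub>pres_group A R\<^esub> x = \<one>\<^bsub>pres_group A R\<^esub>"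
    by (simp only: gclass_mult inverse_word_in_lists one_pres_group)
      (simp add: gclass_eq_iff inverse_word_left)
  then show "\<exists>y\<in>carrier (pres_group A R). y \<otimes>\<^bsub>pres_group A R\<^esub> x = \<one>\<^bsub>pres_group A R\<^esub>"
    using w inverse_word_in_lists[OF w(1)]
    by (auto simp: carrier_pres_group del: in_listsD)
qed (use monoid_pres_group[of A R] in \<open>simp_all add: monoid.m_closed monoid.m_assoc\<close>)

lemma pos_word_simps [simp]:
  "pos_word [] = []" "pos_word (g # w) = (g, True) # pos_word w"
  "pos_word (u @ v) = pos_word u @ pos_word v"
  by (simp_all add: pos_word_def)

lemma pos_word_in_lists: "w \<in> lists A \<Longrightarrow> pos_word w \<in> lists (A \<times> UNIV)"
  by (induction w) auto

lemma meq_imp_geq: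
  assumes "equivclp (mstep R) u v"
  shows "equivclp (gstep R) (pos_word u) (pos_word v)"
  using assms
proof (rule equivclp_lift)
  fix a b assume "mstep R a b"
  then have "gstep R (pos_word a) (pos_word b)"
    by cases (auto intro: gstep.rel)
  then show "equivclp (gstep R) (pos_word a) (pos_word b)"
    by (rule r_into_equivclp)
qed

lemma canon_mclass:
  assumes "u \<in> lists A"
  shows "canon A R (mclass A R u) = gclass A R (pos_word u)"
proof -
  have "gclass A R (pos_word w) = gclass A R (pos_word u)" if "w \<in> mclass A R u" for w
    using that assms
    by (subst gclass_eq_iff)
      (auto simp: mclass_def pos_word_in_lists
        intro: equivclp_sym meq_imp_geq)
  moreover have "u \<in> mclass A R u"
    using assms by (simp add: mclass_def)
  ultimately have "{gclass A R (pos_word w) |w. w \<in> mclass A R u} = {gclass A R (pos_word u)}"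
    by blast
  then show ?thesis by (simp add: canon_def)
qed

lemma canon_hom: "canon A R \<in> hom (pres_monoid A R) (pres_group A R)"
  by (rule homI)
    (auto simp: carrier_pres_monoid carrier_pres_group canon_mclass mclass_mult gclass_mult
      pos_word_in_lists del: in_listsD)

section \<open>Evaluation of signed words: the universal property of a presentation\<close>

definition word_value :: "('a, 'b) monoid_scheme \<Rightarrow> ('g \<Rightarrow> 'a) \<Rightarrow> ('g \<times> bool) list \<Rightarrow> 'a" where
  "word_value G f w = foldr (\<lambda>(g, b) r. (if b then f g else inv\<^bsub>G\<^esub> f g) \<otimes>\<^bsub>G\<^esub> r) w \<one>\<^bsub>G\<^esub>"

lemma word_value_simps [simp]:
  "word_value G f [] = \<one>\<^bsub>G\<^esub>"
  "word_value G f ((g, b) # w) = (if b then f g else inv\<^bsub>G\<^esub> f g) \<otimes>\<^bsub>G\<^esub> word_value G f w"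
  by (simp_all add: word_value_def)

context group
begin

lemma word_value_closed [simp]:
  "range f \<subseteq> carrier G \<Longrightarrow> word_value G f w \<in> carrier G"
  by (induction w) (auto simp: range_subsetD)

lemma word_value_append:
  "range f \<subseteq> carrier G \<Longrightarrow>
    word_value G f (u @ v) = word_value G f u \<otimes> word_value G f v"
  by (induction u) (auto simp: range_subsetD m_assoc)

text \<open>A chain of steps may insert inverse pairs of letters foreign to the generating set, so
  \<open>f\<close> has to send every letter into the carrier.\<close>

lemma word_value_geq:
  assumes f: "range f \<subseteq> carrier G"
    and R: "\<And>p q. (p, q) \<in> R \<Longrightarrow> word_value G f (pos_word p) = word_value G f (pos_word q)"
    and "equivclp (gstep R) u v"
  shows "word_value G f u = word_value G f v"
  using assms(3)
proof (rule equivclp_invariant)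
  fix a b assume "gstep R a b"
  then show "word_value G f a = word_value G f b"
  proof cases
    case (cancel u x c v)
    have "f x \<in> carrier G" using f by auto
    then show ?thesis using f
      by (cases c) (simp_all add: cancel word_value_append flip: m_assoc)
  next
    case (rel p q u v)
    then show ?thesis using f R by (simp add: word_value_append)
  qed
qed

text \<open>The homomorphism induced by the images \<open>f\<close> of the generators. The choice of
  a representative is harmless as soon as \<open>f\<close> respects the relations.\<close>

definition lift_hom :: "('g \<Rightarrow> 'a) \<Rightarrow> ('g \<times> bool) list set \<Rightarrow> 'a" where
  "lift_hom f X = word_value G f (SOME w. w \<in> X)"

lemma lift_hom_gclass:
  assumes "range f \<subseteq> carrier G"
    and "\<And>p q. (p, q) \<in> R \<Longrightarrow> word_value G f (pos_word p) = word_value G f (pos_word q)"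
    and "w \<in> lists (A \<times> UNIV)"
  shows "lift_hom f (gclass A R w) = word_value G f w"
proof -
  have "w \<in> gclass A R w" using assms(3) by (simp add: gclass_def)
  then have "(SOME w'. w' \<in> gclass A R w) \<in> gclass A R w" by (rule someI)
  then have "equivclp (gstep R) w (SOME w'. w' \<in> gclass A R w)"
    by (simp add: gclass_def)
  from word_value_geq[OF assms(1,2) this] show ?thesis
    by (simp add: lift_hom_def)
qed

lemma lift_hom_hom:
  assumes "range f \<subseteq> carrier G"
    and "\<And>p q. (p, q) \<in> R \<Longrightarrow> word_value G f (pos_word p) = word_value G f (pos_word q)"
  shows "lift_hom f \<in> hom (pres_group A R) G"
proof (rule homI)
  show "lift_hom f x \<in> carrier G" if "x \<in> carrier (pres_group A R)" for x
    using that assms(1) by (simp add: lift_hom_def)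
  show "lift_hom f (x \<otimes>\<^bsub>pres_group A R\<^esub> y) = lift_hom f x \<otimes> lift_hom f y"
    if "x \<in> carrier (pres_group A R)" "y \<in> carrier (pres_group A R)" for x y
  proof -
    obtain u v where uv: "u \<in> lists (A \<times> UNIV)" "v \<in> lists (A \<times> UNIV)"
      "x = gclass A R u" "y = gclass A R v"
      using \<open>x \<in> _\<close> \<open>y \<in> _\<close> by (auto simp: carrier_pres_group)
    then have "u @ v \<in> lists (A \<times> UNIV)" by simp
    then show ?thesis
      using uv by (simp add: gclass_mult lift_hom_gclass[OF assms] word_value_append[OF assms(1)]
          del: append_in_lists_conv)
  qed
qed

end

lemma gclass_induct [consumes 1, case_names one pos neg]:
  assumes "w \<in> lists (A \<times> UNIV)"
    and "P (gclass A R [])"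
    and "\<And>g x. g \<in> A \<Longrightarrow> x \<in> carrier (pres_group A R) \<Longrightarrow> P x \<Longrightarrow>
      P (gclass A R [(g, True)] \<otimes>\<^bsub>pres_group A R\<^esub> x)"
    and "\<And>g x. g \<in> A \<Longrightarrow> x \<in> carrier (pres_group A R) \<Longrightarrow> P x \<Longrightarrow>
      P (inv\<^bsub>pres_group A R\<^esub> gclass A R [(g, True)] \<otimes>\<^bsub>pres_group A R\<^esub> x)"
  shows "P (gclass A R w)"
  using assms(1)
proof (induction w rule: lists.induct)
  case Nil
  show ?case by (rule assms(2))
next
  case (Cons l w)
  interpret group "pres_group A R" by (rule group_pres_group)
  obtain g b where l: "l = (g, b)" and g: "g \<in> A" using Cons by auto
  have cl: "[(g, c)] \<in> lists (A \<times> UNIV)" for c using g by simp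
  have w: "gclass A R w \<in> carrier (pres_group A R)"
    using Cons by (simp add: carrier_pres_group)
  have eq: "gclass A R (l # w) = gclass A R [(g, b)] \<otimes>\<^bsub>pres_group A R\<^esub> gclass A R w"
    using gclass_mult[OF cl, of w R b] Cons by (simp add: l)
  have "gclass A R [(g, False)] \<otimes>\<^bsub>pres_group A R\<^esub> gclass A R [(g, True)]
      = \<one>\<^bsub>pres_group A R\<^esub>"
    using gclass_mult[OF cl cl, of R False True] inverse_word_left[of R "[(g, True)]"]
    by (simp add: one_pres_group gclass_eq_iff)
  then have "inv\<^bsub>pres_group A R\<^esub> gclass A R [(g, True)] = gclass A R [(g, False)]"
    using cl by (intro inv_equality) (auto simp: carrier_pres_group)
  then show ?case
    using assms(3)[OF g w Cons.IH] assms(4)[OF g w Cons.IH] by (cases b) (simp_all add: eq)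
qed

text \<open>Serves to verify on generators alone that two homomorphisms between presented groups are
  mutually inverse.\<close>

lemma hom_fixing_generators:
  assumes "\<phi> \<in> hom (pres_group A R) (pres_group A R)"
    and "\<And>g. g \<in> A \<Longrightarrow> \<phi> (gclass A R [(g, True)]) = gclass A R [(g, True)]"
    and "z \<in> carrier (pres_group A R)"
  shows "\<phi> z = z"
proof -
  interpret group "pres_group A R" by (rule group_pres_group)
  interpret group_hom "pres_group A R" "pres_group A R" \<phi>
    using assms(1) by unfold_locales
  obtain w where w: "w \<in> lists (A \<times> UNIV)" "z = gclass A R w"
    using assms(3) by (auto simp: carrier_pres_group)
  have cl: "gclass A R [(g, True)] \<in> carrier (pres_group A R)" if "g \<in> A" for g
    using that by (auto simp: carrier_pres_group)
  have "\<phi> (gclass A R w) = gclass A R w"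
    using w(1)
  proof (induction rule: gclass_induct)
    case one
    show ?case using hom_one by (simp add: one_pres_group)
  qed (simp_all add: assms(2) cl)
  then show ?thesis using w by simp
qed

lemma gclass_replicate:
  assumes "g \<in> A"
  shows "gclass A R (pos_word (replicate k g)) = gclass A R [(g, True)] [^]\<^bsub>pres_group A R\<^esub> k"
proof (induction k)
  case 0
  show ?case by (simp add: one_pres_group)
next
  case (Suc k)
  have "pos_word (replicate k g) \<in> lists (A \<times> UNIV)"
    using assms by (intro pos_word_in_lists) auto
  moreover have "pos_word (replicate (Suc k) g) = pos_word (replicate k g) @ [(g, True)]"
    unfolding replicate_Suc replicate_append_same[symmetric] by simp
  ultimately show ?case
    using assms gclass_mult[of "pos_word (replicate k g)" A "[(g, True)]" R]
    by (simp add: Suc.IH)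
qed

section \<open>Cancellative monoids with lcms of atoms and a central Garside element\<close>

lemma ldvdI: "b \<in> carrier M \<Longrightarrow> c = a \<otimes>\<^bsub>M\<^esub> b \<Longrightarrow> ldvd M a c"
  by (auto simp: ldvd_def)

lemma rdvdI: "b \<in> carrier M \<Longrightarrow> c = b \<otimes>\<^bsub>M\<^esub> a \<Longrightarrow> rdvd M a c"
  by (auto simp: rdvd_def)

text \<open>The Garside axioms reduced to data that can be checked on generators: lcms are asked
  only of pairs of atoms and only for left divisibility. The additive weight yields Noetherianity
  and measures the extremality arguments; the central \<Delta> supplies common multiples.\<close>

locale atomic_lcm_monoid = monoid M for M (structure) +
  fixes S :: "'a set" and wt :: "'a \<Rightarrow> nat" and \<Delta> :: 'a
  assumes left_cancel: "\<lbrakk>a \<otimes> b = a \<otimes> c; a \<in> carrier M; b \<in> carrier M; c \<in> carrier M\<rbrakk> \<Longrightarrow> b = c"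
    and right_cancel: "\<lbrakk>b \<otimes> a = c \<otimes> a; a \<in> carrier M; b \<in> carrier M; c \<in> carrier M\<rbrakk> \<Longrightarrow> b = c"
    and wt_mult: "\<lbrakk>a \<in> carrier M; b \<in> carrier M\<rbrakk> \<Longrightarrow> wt (a \<otimes> b) = wt a + wt b"
    and S_closed: "S \<subseteq> carrier M"
    and finite_S: "finite S"
    and wt_S: "s \<in> S \<Longrightarrow> wt s > 0"
    and S_generates: "a \<in> carrier M \<Longrightarrow> \<exists>xs. set xs \<subseteq> S \<and> a = foldr (\<otimes>) xs \<one>"
    and S_lcm: "\<lbrakk>s \<in> S; t \<in> S\<rbrakk> \<Longrightarrow> \<exists>c. is_lcm_wrt M (ldvd M) s t c"
    and Delta_closed: "\<Delta> \<in> carrier M"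
    and Delta_central: "a \<in> carrier M \<Longrightarrow> a \<otimes> \<Delta> = \<Delta> \<otimes> a"
    and S_ldvd_Delta: "s \<in> S \<Longrightarrow> ldvd M s \<Delta>"
begin

lemma foldr_closed: "set xs \<subseteq> S \<Longrightarrow> foldr (\<otimes>) xs \<one> \<in> carrier M"
  using S_closed by (induction xs) auto

lemma length_le_wt: "set xs \<subseteq> S \<Longrightarrow> length xs \<le> wt (foldr (\<otimes>) xs \<one>)"
proof (induction xs)
  case (Cons s xs)
  then have "s \<in> carrier M" "wt s > 0" using S_closed wt_S by auto
  with Cons show ?case by (simp add: wt_mult foldr_closed)
qed simp

lemma atom_factor:
  assumes "a \<in> carrier M" "a \<noteq> \<one>"
  obtains s b where "s \<in> S" "s \<in> carrier M" "b \<in> carrier M" "a = s \<otimes> b"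
proof -
  obtain xs where xs: "set xs \<subseteq> S" "a = foldr (\<otimes>) xs \<one>"
    using S_generates assms(1) by blast
  then obtain s ys where "xs = s # ys" using assms(2) by (cases xs) auto
  then show thesis using that[of s "foldr (\<otimes>) ys \<one>"] xs S_closed foldr_closed by auto
qed

lemma wt_eq_0: "a \<in> carrier M \<Longrightarrow> wt a = 0 \<Longrightarrow> a = \<one>"
  by (metis atom_factor wt_mult wt_S add_is_0 less_numeral_extra(3))

text \<open>Write a = s a' and b = t b' with atoms s, t, and let m = s u = t v be the lcm of s and
  t. With l = u w the lcm of a' and u, and k the lcm of b' and v w, the lcm of a and b is t k. Both
  smaller lcms exist by induction, since cancelling an atom from c leaves a common multiple of lower
  weight.\<close>

lemma left_lcm_if_common_multiple:
  assumes "a \<in> carrier M" "b \<in> carrier M" "c \<in> carrier M" "ldvd M a c" "ldvd M b c"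
  shows "\<exists>l. is_lcm_wrt M (ldvd M) a b l"
  using assms
proof (induction "wt c" arbitrary: a b c rule: less_induct)
  case less
  note [simp] = m_assoc
  consider "a = \<one>" | "b = \<one>" | "a \<noteq> \<one>" "b \<noteq> \<one>" by blast
  then show ?case
  proof cases
    case 1
    then have "is_lcm_wrt M (ldvd M) a b b"
      using less.prems by (auto simp: is_lcm_wrt_def intro: ldvdI[of \<one>] ldvdI[of b])
    then show ?thesis ..
  next
    case 2
    then have "is_lcm_wrt M (ldvd M) a b a"
      using less.prems by (auto simp: is_lcm_wrt_def intro: ldvdI[of \<one>] ldvdI[of a])
    then show ?thesis ..
  next
    case 3
    obtain s a' where s: "s \<in> S" "s \<in> carrier M" "a' \<in> carrier M" "a = s \<otimes> a'"
      using atom_factor 3 less.prems by metis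
    obtain t b' where t: "t \<in> S" "t \<in> carrier M" "b' \<in> carrier M" "b = t \<otimes> b'"
      using atom_factor 3 less.prems by metis
    obtain p q where p: "p \<in> carrier M" "c = a \<otimes> p" and q: "q \<in> carrier M" "c = b \<otimes> q"
      using less.prems by (auto simp: ldvd_def)
    obtain m where m: "m \<in> carrier M" "ldvd M s m" "ldvd M t m"
      and m_least: "\<And>d. \<lbrakk>d \<in> carrier M; ldvd M s d; ldvd M t d\<rbrakk> \<Longrightarrow> ldvd M m d"
      using S_lcm[OF s(1) t(1)] by (auto simp: is_lcm_wrt_def)
    obtain u v where u: "u \<in> carrier M" "m = s \<otimes> u" and v: "v \<in> carrier M" "m = t \<otimes> v"
      using m by (auto simp: ldvd_def)
    \<comment> \<open>A common multiple of a and b is some m r; cancelling s and t produces the same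
      remainder r on both sides.\<close>
    have split: "\<exists>r\<in>carrier M. a' \<otimes> x = u \<otimes> r \<and> b' \<otimes> y = v \<otimes> r"
      if "x \<in> carrier M" "y \<in> carrier M" "a \<otimes> x = b \<otimes> y" for x y
    proof -
      have "ldvd M s (a \<otimes> x)" "ldvd M t (a \<otimes> x)"
        using that s t by (auto intro: ldvdI[of "a' \<otimes> x"] ldvdI[of "b' \<otimes> y"])
      then have "ldvd M m (a \<otimes> x)" using m_least that less.prems(1) by blast
      then obtain r where r: "r \<in> carrier M" "a \<otimes> x = m \<otimes> r"
        by (auto simp: ldvd_def)
      have "a' \<otimes> x = u \<otimes> r"
        by (rule left_cancel[of s]) (use r s u that in auto)
      moreover have "b' \<otimes> y = v \<otimes> r"
        by (rule left_cancel[of t]) (use r t v that in auto)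
      ultimately show ?thesis using r by blast
    qed
    obtain c' where c': "c' \<in> carrier M" "a' \<otimes> p = u \<otimes> c'" "b' \<otimes> q = v \<otimes> c'"
      using split[of p q] p q by auto
    have "wt (a' \<otimes> p) < wt c"
      using p s wt_S[of s] by (simp add: wt_mult)
    moreover have "ldvd M a' (a' \<otimes> p)" "ldvd M u (a' \<otimes> p)"
      using p c' by (auto intro: ldvdI)
    ultimately have "\<exists>l. is_lcm_wrt M (ldvd M) a' u l"
      using p s u by (intro less.hyps[of "a' \<otimes> p"]) auto
    then obtain l where l: "l \<in> carrier M" "ldvd M a' l" "ldvd M u l"
      and l_least: "\<And>d. \<lbrakk>d \<in> carrier M; ldvd M a' d; ldvd M u d\<rbrakk> \<Longrightarrow> ldvd M l d"
      unfolding is_lcm_wrt_def by blast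
    obtain w g where w: "w \<in> carrier M" "l = u \<otimes> w" and g: "g \<in> carrier M" "l = a' \<otimes> g"
      using l by (auto simp: ldvd_def)
    \<comment> \<open>Here u r is a common multiple of a' and u, hence a multiple of l = u w;
      cancelling u shows that w divides r.\<close>
    have step: "ldvd M w r" if "r \<in> carrier M" "x \<in> carrier M" "a' \<otimes> x = u \<otimes> r" for r x
    proof -
      have "ldvd M l (u \<otimes> r)"
        using l_least that u s by (metis ldvdI m_closed)
      then obtain h where h: "h \<in> carrier M" "u \<otimes> r = u \<otimes> (w \<otimes> h)"
        using w u by (auto simp: ldvd_def)
      then have "r = w \<otimes> h" using left_cancel[of u] that u w by simp
      then show ?thesis using h by (auto intro: ldvdI)
    qed
    have "wt (b' \<otimes> q) < wt c"
      using q t wt_S[of t] by (simp add: wt_mult)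
    moreover have "ldvd M (v \<otimes> w) (b' \<otimes> q)"
      using step[OF c'(1) p(1) c'(2)] c' v w by (auto simp: ldvd_def)
    moreover have "ldvd M b' (b' \<otimes> q)" using q by (auto intro: ldvdI)
    ultimately have "\<exists>k. is_lcm_wrt M (ldvd M) b' (v \<otimes> w) k"
      using q t v w by (intro less.hyps[of "b' \<otimes> q"]) auto
    then obtain k where k: "k \<in> carrier M" "ldvd M b' k" "ldvd M (v \<otimes> w) k"
      and k_least: "\<And>d. \<lbrakk>d \<in> carrier M; ldvd M b' d; ldvd M (v \<otimes> w) d\<rbrakk> \<Longrightarrow> ldvd M k d"
      unfolding is_lcm_wrt_def by blast
    have "is_lcm_wrt M (ldvd M) a b (t \<otimes> k)"
      unfolding is_lcm_wrt_def
    proof (intro conjI ballI impI)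
      show "t \<otimes> k \<in> carrier M" using t k by simp
      show "ldvd M b (t \<otimes> k)" using k t by (auto simp: ldvd_def)
      obtain f where f: "f \<in> carrier M" "k = v \<otimes> w \<otimes> f" using k by (auto simp: ldvd_def)
      have "t \<otimes> k = m \<otimes> (w \<otimes> f)" using f t v w by simp
      also have "\<dots> = s \<otimes> (l \<otimes> f)" using f s u w by simp
      also have "\<dots> = a \<otimes> (g \<otimes> f)" using f s g by simp
      finally show "ldvd M a (t \<otimes> k)" using f g by (auto intro: ldvdI)
      fix d assume "d \<in> carrier M" "ldvd M a d \<and> ldvd M b d"
      then obtain x y where x: "x \<in> carrier M" "d = a \<otimes> x" and y: "y \<in> carrier M" "d = b \<otimes> y"
        by (auto simp: ldvd_def)
      then obtain r where r: "r \<in> carrier M" "a' \<otimes> x = u \<otimes> r" "b' \<otimes> y = v \<otimes> r"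
        using split by metis
      have "ldvd M (v \<otimes> w) (b' \<otimes> y)"
        using step[OF r(1) x(1) r(2)] r v w by (auto simp: ldvd_def)
      then have "ldvd M k (b' \<otimes> y)" using k_least y t by (metis ldvdI m_closed)
      then show "ldvd M (t \<otimes> k) d" using y t k by (auto simp: ldvd_def)
    qed
    then show ?thesis ..
  qed
qed

section \<open>Complements in powers of \<Delta>, and the remaining lcms and gcds\<close>

lemma Delta_pow_central:
  "a \<in> carrier M \<Longrightarrow> a \<otimes> \<Delta> [^] (k::nat) = \<Delta> [^] k \<otimes> a"
proof (induction k)
  case (Suc k)
  then show ?case
    using Delta_closed Delta_central by (metis m_assoc nat_pow_Suc nat_pow_closed)
qed simp

text \<open>a (b a) = \<Delta>^k a = a \<Delta>^k by centrality, and a cancels.\<close>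

lemma complement_commute:
  assumes "a \<in> carrier M" "b \<in> carrier M" "a \<otimes> b = \<Delta> [^] (k::nat)"
  shows "b \<otimes> a = \<Delta> [^] k"
proof (rule left_cancel[of a])
  show "a \<otimes> (b \<otimes> a) = a \<otimes> \<Delta> [^] k"
    using assms Delta_pow_central by (simp flip: m_assoc)
qed (use assms Delta_closed in auto)

text \<open>One factor \<Delta> per atom suffices: if a b = \<Delta>^k and s t = \<Delta>, then s a
  b t = \<Delta>^k s t = \<Delta>^(k+1).\<close>

lemma ex_complement:
  assumes "a \<in> carrier M"
  shows "\<exists>k::nat. \<exists>b\<in>carrier M. a \<otimes> b = \<Delta> [^] k"
proof -
  have "\<exists>k::nat. \<exists>b\<in>carrier M. foldr (\<otimes>) xs \<one> \<otimes> b = \<Delta> [^] k" if "set xs \<subseteq> S" for xs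
    using that
  proof (induction xs)
    case Nil
    have "foldr (\<otimes>) [] \<one> \<otimes> \<one> = \<Delta> [^] (0::nat)" by simp
    then show ?case by blast
  next
    case (Cons s xs)
    define a where "a = foldr (\<otimes>) xs \<one>"
    have cl: "a \<in> carrier M" "s \<in> carrier M"
      using Cons S_closed by (auto simp: a_def foldr_closed)
    obtain k :: nat and b where b: "b \<in> carrier M" "a \<otimes> b = \<Delta> [^] k"
      using Cons by (auto simp: a_def)
    obtain t where t: "t \<in> carrier M" "\<Delta> = s \<otimes> t"
      using S_ldvd_Delta Cons by (auto simp: ldvd_def)
    have "s \<otimes> a \<otimes> (b \<otimes> t) = s \<otimes> (a \<otimes> b) \<otimes> t"
      using cl b(1) t(1) by (simp add: m_assoc)
    also have "\<dots> = \<Delta> [^] k \<otimes> (s \<otimes> t)"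
      unfolding b(2) using cl t(1) Delta_closed by (simp add: Delta_pow_central m_assoc)
    also have "\<dots> = \<Delta> [^] Suc k" using t by simp
    finally have "foldr (\<otimes>) (s # xs) \<one> \<otimes> (b \<otimes> t) = \<Delta> [^] Suc k" by (simp add: a_def)
    then show ?case using b t by blast
  qed
  then show ?thesis using S_generates[OF assms] by blast
qed

lemma ex_common_complement:
  assumes "a \<in> carrier M" "b \<in> carrier M"
  obtains k :: nat and a' b' where "a' \<in> carrier M" "b' \<in> carrier M"
    "a \<otimes> a' = \<Delta> [^] k" "a' \<otimes> a = \<Delta> [^] k" "b \<otimes> b' = \<Delta> [^] k" "b' \<otimes> b = \<Delta> [^] k"
proof -
  obtain k l :: nat and a' b' where *: "a' \<in> carrier M" "a \<otimes> a' = \<Delta> [^] k"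
    "b' \<in> carrier M" "b \<otimes> b' = \<Delta> [^] l"
    using ex_complement assms by metis
  \<comment> \<open>Padding each complement with the exponent of the other brings both products to
    \<Delta>^(k+l).\<close>
  define x y where "x = a' \<otimes> \<Delta> [^] l" and "y = b' \<otimes> \<Delta> [^] k"
  have xy: "x \<in> carrier M" "y \<in> carrier M" using * Delta_closed by (simp_all add: x_def y_def)
  have x: "a \<otimes> x = \<Delta> [^] (k + l)"
    using * assms Delta_closed by (simp add: x_def nat_pow_mult flip: m_assoc)
  have y: "b \<otimes> y = \<Delta> [^] (k + l)"
    using * assms Delta_closed by (simp add: y_def nat_pow_mult add.commute flip: m_assoc)
  show thesis
    by (rule that[OF xy x complement_commute[OF assms(1) xy(1) x]
          y complement_commute[OF assms(2) xy(2) y]])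
qed

lemma ex_ldvd_lcm:
  assumes "a \<in> carrier M" "b \<in> carrier M"
  shows "\<exists>c. is_lcm_wrt M (ldvd M) a b c"
proof -
  obtain k :: nat and a' b' where "a' \<in> carrier M" "b' \<in> carrier M"
    "a \<otimes> a' = \<Delta> [^] k" "b \<otimes> b' = \<Delta> [^] k"
    using ex_common_complement assms by metis
  then show ?thesis
    using assms Delta_closed
    by (intro left_lcm_if_common_multiple[of a b "\<Delta> [^] k"]) (auto simp: ldvd_def intro: sym)
qed

text \<open>A common left divisor of maximal weight absorbs its lcm with any other one.\<close>

lemma ex_ldvd_gcd:
  assumes "a \<in> carrier M" "b \<in> carrier M"
  shows "\<exists>c. is_gcd_wrt M (ldvd M) a b c"
proof -
  define C where "C c \<longleftrightarrow> c \<in> carrier M \<and> ldvd M c a \<and> ldvd M c b" for c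
  have "C \<one>" using assms by (auto simp: C_def ldvd_def)
  moreover have "\<forall>c. C c \<longrightarrow> wt c < Suc (wt a)"
    by (auto simp: C_def ldvd_def wt_mult)
  ultimately obtain c where c: "C c" and max: "\<And>d. C d \<Longrightarrow> wt d \<le> wt c"
    using ex_has_greatest_nat[of C \<one> wt "Suc (wt a)"] by auto
  have "ldvd M d c" if d: "C d" for d
  proof -
    obtain l where l: "is_lcm_wrt M (ldvd M) c d l"
      using ex_ldvd_lcm c d by (auto simp: C_def)
    then have "C l" using c d assms by (auto simp: C_def is_lcm_wrt_def)
    obtain e where e: "e \<in> carrier M" "l = c \<otimes> e"
      using l by (auto simp: is_lcm_wrt_def ldvd_def)
    then have "wt e = 0" using max[OF \<open>C l\<close>] c by (simp add: wt_mult C_def)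
    then have "l = c" using e wt_eq_0[OF e(1)] c by (simp add: C_def)
    then show ?thesis using l by (simp add: is_lcm_wrt_def)
  qed
  then have "is_gcd_wrt M (ldvd M) a b c" using c by (auto simp: is_gcd_wrt_def C_def)
  then show ?thesis ..
qed

text \<open>Taking complements in a power of \<open>\<Delta>\<close> reverses the order and exchanges
  left and right divisibility.\<close>

lemma ex_rdvd_gcd:
  assumes "a \<in> carrier M" "b \<in> carrier M"
  shows "\<exists>c. is_gcd_wrt M (rdvd M) a b c"
proof -
  obtain k :: nat and a' b' where ab: "a' \<in> carrier M" "b' \<in> carrier M"
    "a' \<otimes> a = \<Delta> [^] k" "b' \<otimes> b = \<Delta> [^] k"
    using ex_common_complement assms by metis
  obtain m where m: "m \<in> carrier M" "ldvd M a' m" "ldvd M b' m"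
    and m_least: "\<And>d. \<lbrakk>d \<in> carrier M; ldvd M a' d; ldvd M b' d\<rbrakk> \<Longrightarrow> ldvd M m d"
    using ex_ldvd_lcm[OF ab(1,2)] by (auto simp: is_lcm_wrt_def)
  have "ldvd M m (\<Delta> [^] k)"
    using ab assms Delta_closed by (intro m_least) (auto simp: ldvd_def intro: sym)
  then obtain c where c: "c \<in> carrier M" "m \<otimes> c = \<Delta> [^] k" by (auto simp: ldvd_def)
  \<comment> \<open>If m = z' u, then z' u c = m c = \<Delta>^k = z' z, so z = u c.\<close>
  have dual: "rdvd M c z" if z: "z \<in> carrier M" "z' \<in> carrier M" "z' \<otimes> z = \<Delta> [^] k" "ldvd M z' m"
    for z z'
  proof -
    obtain u where u: "u \<in> carrier M" "m = z' \<otimes> u" using z by (auto simp: ldvd_def)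
    have "z = u \<otimes> c"
      by (rule left_cancel[of z']) (use u c z in \<open>simp_all flip: m_assoc\<close>)
    then show ?thesis using u by (auto intro: rdvdI)
  qed
  have "is_gcd_wrt M (rdvd M) a b c"
    unfolding is_gcd_wrt_def
  proof (intro conjI ballI impI)
    show "c \<in> carrier M" by (rule c)
    show "rdvd M c a" "rdvd M c b" using dual assms ab m by auto
    fix d assume d: "d \<in> carrier M" "rdvd M d a \<and> rdvd M d b"
    then obtain e f where ef: "e \<in> carrier M" "a = e \<otimes> d" "f \<in> carrier M" "b = f \<otimes> d"
      by (auto simp: rdvd_def)
    \<comment> \<open>Both sides become \<Delta>^k after multiplication by d on the right.\<close>
    have "a' \<otimes> e = b' \<otimes> f"
      by (rule right_cancel[of _ d]) (use d ef ab in \<open>simp_all add: m_assoc\<close>)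
    then have "ldvd M m (a' \<otimes> e)"
      using ef ab by (intro m_least) (auto intro: ldvdI)
    then obtain t where t: "t \<in> carrier M" "a' \<otimes> e = m \<otimes> t" by (auto simp: ldvd_def)
    have "m \<otimes> (t \<otimes> d) = a' \<otimes> e \<otimes> d" using t m d by (simp add: m_assoc)
    also have "\<dots> = m \<otimes> c" using ab ef d c by (simp add: m_assoc)
    finally have "t \<otimes> d = c"
      using left_cancel[of m "t \<otimes> d" c] t d c m by simp
    then show "rdvd M d c" using t by (auto intro: rdvdI)
  qed
  then show ?thesis ..
qed

text \<open>Some power of \<Delta> is a common left-multiple, so one of least weight exists. Its
  right-gcd with any other common left-multiple is again one, hence has the same weight and equals
  it.\<close>

lemma ex_rdvd_lcm:
  assumes "a \<in> carrier M" "b \<in> carrier M"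
  shows "\<exists>c. is_lcm_wrt M (rdvd M) a b c"
proof -
  define C where "C c \<longleftrightarrow> c \<in> carrier M \<and> rdvd M a c \<and> rdvd M b c" for c
  obtain k :: nat and a' b' where "a' \<in> carrier M" "b' \<in> carrier M"
    "a' \<otimes> a = \<Delta> [^] k" "b' \<otimes> b = \<Delta> [^] k"
    using ex_common_complement assms by metis
  then have "C (\<Delta> [^] k)"
    using Delta_closed by (auto simp: C_def rdvd_def intro: sym)
  then obtain c where c: "C c" and min: "\<And>d. C d \<Longrightarrow> wt c \<le> wt d"
    using ex_has_least_nat[of C "\<Delta> [^] k" wt] by auto
  have "rdvd M c d" if d: "C d" for d
  proof -
    obtain l where l: "is_gcd_wrt M (rdvd M) c d l"
      using ex_rdvd_gcd c d by (auto simp: C_def)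
    then have "C l" using c d assms by (auto simp: C_def is_gcd_wrt_def)
    obtain e where e: "e \<in> carrier M" "c = e \<otimes> l"
      using l by (auto simp: is_gcd_wrt_def rdvd_def)
    then have "wt e = 0" using min[OF \<open>C l\<close>] \<open>C l\<close> by (simp add: wt_mult C_def)
    then have "l = c" using e wt_eq_0[OF e(1)] \<open>C l\<close> by (simp add: C_def)
    then show ?thesis using l by (simp add: is_gcd_wrt_def)
  qed
  then have "is_lcm_wrt M (rdvd M) a b c" using c by (auto simp: is_lcm_wrt_def C_def)
  then show ?thesis ..
qed

text \<open>The weight bounds the length of any word in the atoms, and there are finitely many words
  of bounded length over a finite set.\<close>

lemma finite_ldvd_Delta: "finite {a \<in> carrier M. ldvd M a \<Delta>}"
proof -
  have "{a \<in> carrier M. ldvd M a \<Delta>}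
      \<subseteq> (\<lambda>xs. foldr (\<otimes>) xs \<one>) ` {xs. set xs \<subseteq> S \<and> length xs \<le> wt \<Delta>}"
  proof
    fix a assume "a \<in> {a \<in> carrier M. ldvd M a \<Delta>}"
    then have a: "a \<in> carrier M" "wt a \<le> wt \<Delta>" by (auto simp: ldvd_def wt_mult)
    then obtain xs where "set xs \<subseteq> S" "a = foldr (\<otimes>) xs \<one>" using S_generates by blast
    then show "a \<in> (\<lambda>xs. foldr (\<otimes>) xs \<one>) ` {xs. set xs \<subseteq> S \<and> length xs \<le> wt \<Delta>}"
      using length_le_wt[of xs] a by auto
  qed
  then show ?thesis
    using finite_lists_length_le[OF finite_S] finite_surj by blast
qed

lemma ldvd_Delta_iff_rdvd_Delta:
  assumes "a \<in> carrier M"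
  shows "ldvd M a \<Delta> \<longleftrightarrow> rdvd M a \<Delta>"
proof -
  have "\<Delta> [^] (1::nat) = \<Delta>" using Delta_closed by simp
  then show ?thesis
    unfolding ldvd_def rdvd_def
    using complement_commute[of a _ 1] complement_commute[of _ a 1] assms by metis
qed

theorem garside_monoid: "garside_monoid M \<Delta>"
  unfolding garside_monoid_def
proof (intro conjI ballI)
  show "monoid M" by (rule monoid_axioms)
  show "\<exists>len::'a \<Rightarrow> nat. (\<forall>a\<in>carrier M. \<forall>b\<in>carrier M. len a + len b \<le> len (a \<otimes> b)) \<and>
      (\<forall>a\<in>carrier M. a \<noteq> \<one> \<longrightarrow> len a \<noteq> 0)"
    using wt_mult wt_eq_0 by (intro exI[of _ wt]) auto
  show "{a \<in> carrier M. ldvd M a \<Delta>} = {a \<in> carrier M. rdvd M a \<Delta>}"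
    using ldvd_Delta_iff_rdvd_Delta by blast
  show "\<exists>xs. set xs \<subseteq> {a \<in> carrier M. ldvd M a \<Delta>} \<and> x = foldr (\<otimes>) xs \<one>"
    if "x \<in> carrier M" for x
    using S_generates[OF that] S_closed S_ldvd_Delta by blast
  show "a \<otimes> b = a \<otimes> c \<longrightarrow> b = c" "b \<otimes> a = c \<otimes> a \<longrightarrow> b = c"
    if "a \<in> carrier M" "b \<in> carrier M" "c \<in> carrier M" for a b c
    using left_cancel right_cancel that by blast+
qed (simp_all add: Delta_closed ex_ldvd_lcm ex_rdvd_lcm ex_ldvd_gcd ex_rdvd_gcd finite_ldvd_Delta)

end

section \<open>Normal forms in the torus knot group\<close>

locale torus_normal_forms =
  fixes n :: nat
  assumes n_pos: "n \<ge> 1"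
begin

text \<open>A pair (m, l) stands for \<Delta>^m times the product of the syllables in l, where
  (True, a) is x^a and (False, b) is y^b. \<open>ord\<close> is the exponent at which a power of x
  or of y becomes \<Delta>.\<close>

definition ord :: "bool \<Rightarrow> int" where
  "ord s = (if s then int n else int n + 1)"

definition head_exp :: "bool \<Rightarrow> (bool \<times> int) list \<Rightarrow> int" where
  "head_exp s l = (case l of [] \<Rightarrow> 0 | (s', a) # t \<Rightarrow> if s' = s then a else 0)"

definition strip :: "bool \<Rightarrow> (bool \<times> int) list \<Rightarrow> (bool \<times> int) list" where
  "strip s l = (case l of [] \<Rightarrow> [] | (s', a) # t \<Rightarrow> if s' = s then t else l)"

definition push :: "bool \<Rightarrow> int \<Rightarrow> (bool \<times> int) list \<Rightarrow> (bool \<times> int) list" where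
  "push s c t = (if c = 0 then t else (s, c) # t)"

text \<open>Exponents being positive, a vanishing \<open>head_exp\<close> says that the next
  syllable has the other type, so the types alternate.\<close>

fun reduced :: "(bool \<times> int) list \<Rightarrow> bool" where
  "reduced [] = True"
| "reduced ((s, a) # l) = (0 < a \<and> a < ord s \<and> head_exp s l = 0 \<and> reduced l)"

text \<open>Left multiplication by x^a or y^a for any integer a: the exponent merges with a leading
  syllable of the same type, and the carry goes into the central power of \<Delta>.\<close>

fun move :: "bool \<Rightarrow> int \<Rightarrow> int \<times> (bool \<times> int) list \<Rightarrow> int \<times> (bool \<times> int) list" where
  "move s a (m, l) = (m + (head_exp s l + a) div ord s,
     push s ((head_exp s l + a) mod ord s) (strip s l))"

declare move.simps [simp del]

lemma ord_pos: "ord s > 0"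
  using n_pos by (simp add: ord_def)

lemma ord_simps [simp]: "ord True = int n" "ord False = int n + 1"
  by (simp_all add: ord_def)

lemma head_exp_simps [simp]:
  "head_exp s [] = 0" "head_exp s ((s', a) # t) = (if s' = s then a else 0)"
  by (simp_all add: head_exp_def)

text \<open>Allowing c = 0 covers in one form the lists that start with an s-syllable and those that
  do not.\<close>

lemma reduced_decompose:
  assumes "reduced l"
  obtains c t where "l = push s c t" "0 \<le> c" "c < ord s" "reduced t" "head_exp s t = 0"
proof (cases "head_exp s l = 0")
  case True
  then show thesis using that[of 0 l] assms ord_pos by (simp add: push_def)
next
  case False
  then obtain c t where "l = (s, c) # t"
    by (auto simp: head_exp_def split: list.splits if_splits)
  then show thesis using that[of c t] assms by (simp add: push_def)
qed

lemma move_push: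
  assumes "reduced t" "head_exp s t = 0"
  shows "move s a (m, push s c t) = (m + (c + a) div ord s, push s ((c + a) mod ord s) t)"
proof -
  have "strip s t = t"
    using assms by (cases t rule: reduced.cases) (auto simp: strip_def split: if_splits)
  then show ?thesis using assms by (simp add: move.simps push_def strip_def)
qed

lemma reduced_push:
  "reduced t \<Longrightarrow> head_exp s t = 0 \<Longrightarrow> 0 \<le> c \<Longrightarrow> c < ord s \<Longrightarrow> reduced (push s c t)"
  by (simp add: push_def)

lemma reduced_move: "reduced (snd v) \<Longrightarrow> reduced (snd (move s a v))"
proof -
  assume "reduced (snd v)"
  then obtain c t where "snd v = push s c t" "reduced t" "head_exp s t = 0"
    by (rule reduced_decompose)
  then show ?thesis
    using move_push[of t s a "fst v" c] ord_pos[of s] reduced_push[of t s] by (cases v) simp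
qed

text \<open>The carries of two successive divisions with remainder add up to the carry of the
  combined one.\<close>

lemma move_move:
  assumes "reduced (snd v)"
  shows "move s a (move s b v) = move s (a + b) v"
proof -
  obtain c t where *: "snd v = push s c t" "reduced t" "head_exp s t = 0"
    using assms by (rule reduced_decompose)
  have "(c + b) div ord s + ((c + b) mod ord s + a) div ord s = (c + (a + b)) div ord s"
  proof -
    have "(c + (a + b)) div ord s = ((c + b) mod ord s + a + ((c + b) div ord s) * ord s) div ord s"
      by (simp add: algebra_simps)
    also have "\<dots> = (c + b) div ord s + ((c + b) mod ord s + a) div ord s"
      using ord_pos[of s] by simp
    finally show ?thesis by simp
  qed
  moreover have "((c + b) mod ord s + a) mod ord s = (c + (a + b)) mod ord s"
    by (simp add: mod_simps algebra_simps)
  ultimately show ?thesis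
    using * move_push[of t s _ _ _] by (cases v) simp
qed

lemma move_ord:
  assumes "reduced (snd v)"
  shows "move s (k * ord s) v = (fst v + k, snd v)"
proof -
  obtain c t where *: "snd v = push s c t" "0 \<le> c" "c < ord s" "reduced t" "head_exp s t = 0"
    using assms by (rule reduced_decompose)
  then show ?thesis
    using move_push[of t s "k * ord s" "fst v" c] by (cases v) simp
qed

lemma move_0: "reduced (snd v) \<Longrightarrow> move s 0 v = v"
  using move_ord[of v s 0] by simp

section \<open>The count that decides membership in the submonoid\<close>

fun excess :: "(bool \<times> int) list \<Rightarrow> int" where
  "excess [] = 0"
| "excess ((s, a) # l) = (if s \<and> a + head_exp False l \<ge> int n + 1 then 1 else 0) + excess l"

text \<open>A counted pair hides one factor \<Delta>, as x^a y^b = \<rho>_a y^(a+b-(n+1)) \<Delta>.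
  \<open>val\<close> adds the hidden factors to the visible exponent; \<open>val_orbit\<close> and
  \<open>orbit_if_val\<close> show that its sign decides membership.\<close>

definition val :: "int \<times> (bool \<times> int) list \<Rightarrow> int" where
  "val v = fst v + excess (snd v)"

lemma head_exp_range: "reduced l \<Longrightarrow> 0 \<le> head_exp s l \<and> head_exp s l < ord s"
  using ord_pos by (cases l rule: reduced.cases) auto

text \<open>This includes a = 0, where nothing is pushed: a leading y-exponent is at most n, so the
  test fails.\<close>

lemma excess_push_True:
  "reduced t \<Longrightarrow> excess (push True a t) = (if a + head_exp False t \<ge> int n + 1 then 1 else 0) + excess t"
  using head_exp_range[of t False] by (auto simp: push_def)

lemma excess_push_False: "excess (push False b t) = excess t"
  by (simp add: push_def)

text \<open>Without a carry the leading x-exponent only grows, which cannot destroy a counted pair.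
  With a carry one \<Delta> is gained, which pays for the one pair that may be lost.\<close>

lemma val_move_True_mono:
  assumes "reduced (snd v)" "0 \<le> i" "i \<le> int n"
  shows "val v \<le> val (move True i v)"
proof -
  obtain a t where *: "snd v = push True a t" "0 \<le> a" "a < int n" "reduced t" "head_exp True t = 0"
    using assms reduced_decompose[of "snd v" True] by (metis ord_simps(1))
  have eq: "move True i v = (fst v + (a + i) div int n, push True ((a + i) mod int n) t)"
    using * move_push[of t True i "fst v" a] by (cases v) simp
  show ?thesis
  proof (cases "a + i < int n")
    case True
    then show ?thesis using * assms eq by (simp add: val_def excess_push_True)
  next
    case False
    then have "(a + i) div int n \<ge> 1"
      using n_pos by (simp add: pos_imp_zdiv_pos_iff int_one_le_iff_zero_less)
    then show ?thesis using * eq by (simp add: val_def excess_push_True)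
  qed
qed

text \<open>Left multiplication by \<rho>_i = x^i y^-i.\<close>

definition gen :: "nat \<Rightarrow> int \<times> (bool \<times> int) list \<Rightarrow> int \<times> (bool \<times> int) list" where
  "gen i v = move True (int i) (move False (- int i) v)"

definition gen_inv :: "nat \<Rightarrow> int \<times> (bool \<times> int) list \<Rightarrow> int \<times> (bool \<times> int) list" where
  "gen_inv i v = move False (int i) (move True (- int i) v)"

lemma reduced_gen: "reduced (snd v) \<Longrightarrow> reduced (snd (gen i v))"
  and reduced_gen_inv: "reduced (snd v) \<Longrightarrow> reduced (snd (gen_inv i v))"
  by (simp_all add: gen_def gen_inv_def reduced_move)

lemma gen_gen_inv: "reduced (snd v) \<Longrightarrow> gen i (gen_inv i v) = v"
  and gen_inv_gen: "reduced (snd v) \<Longrightarrow> gen_inv i (gen i v) = v"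
  by (simp_all add: gen_def gen_inv_def reduced_move move_move move_0)

lemma move_True_n: "reduced (snd v) \<Longrightarrow> move True (int n) v = move False (int n + 1) v"
  using move_ord[of v True 1] move_ord[of v False 1] by simp

lemma gen_n: "reduced (snd v) \<Longrightarrow> gen n v = move False 1 v"
  by (simp add: gen_def move_True_n reduced_move move_move)

lemma gen_relation:
  "reduced (snd v) \<Longrightarrow> gen 1 (gen n (gen i v)) = gen (Suc i) (gen n v)"
  by (simp add: gen_n reduced_gen) (simp add: gen_def reduced_move move_move move_0)

text \<open>If the leading y-exponent b is at least i, then y^-i leaves \<open>val\<close> unchanged
  and x^i does not lower it. Otherwise y^-i costs one \<Delta> and leaves y^c with i + c = b + n +
  1, so the new pair x^i y^c is counted; for i = n the power x^i itself restores the
  \<Delta>.\<close>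

lemma val_gen_mono:
  assumes v: "reduced (snd v)" and "1 \<le> i" "i \<le> n"
  shows "val v \<le> val (gen i v)"
proof -
  obtain b t where *: "snd v = push False b t" "0 \<le> b" "b < int n + 1" "reduced t" "head_exp False t = 0"
    using v reduced_decompose[of "snd v" False] by (metis ord_simps(2))
  have eq: "move False (- int i) v =
      (fst v + (b - int i) div (int n + 1), push False ((b - int i) mod (int n + 1)) t)"
    using * move_push[of t False "- int i" "fst v" b] by (cases v) simp
  show ?thesis
  proof (cases "b \<ge> int i")
    case True
    then have "val (move False (- int i) v) = val v"
      using * eq by (simp add: val_def excess_push_False)
    then show ?thesis
      using val_move_True_mono[of "move False (- int i) v" "int i"] assms
      by (simp add: gen_def reduced_move)
  next
    case False
    have d: "(b - int i) div (int n + 1) = -1"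
      using False * assms by (intro int_div_pos_eq[where r = "b - int i + int n + 1"]) auto
    have m: "(b - int i) mod (int n + 1) = b - int i + int n + 1"
      using False * assms by (intro int_mod_pos_eq[where q = "-1"]) auto
    define c where "c = b - int i + int n + 1"
    have c: "0 < c" "c < int n + 1" using False * assms by (auto simp: c_def)
    have r: "reduced ((False, c) # t)" using * c by simp
    have "move False (- int i) v = (fst v - 1, (False, c) # t)"
      using eq d m c by (simp add: c_def push_def)
    then have "gen i v = (fst v - 1 + int i div int n, push True (int i mod int n) ((False, c) # t))"
      using move_push[OF r, of True "int i" "fst v - 1" 0]
      by (simp add: gen_def push_def)
    then show ?thesis using assms * r c
      by (cases "i = n") (auto simp: val_def excess_push_True excess_push_False c_def)
  qed
qed

text \<open>If \<open>k\<close> starts with a power of x, prepending fewer than n+1 letters y changes nothing;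
  otherwise both \<open>y\<^sup>j\<^sup>-\<^sup>i k\<close> and \<open>x\<^sup>j\<^sup>-\<^sup>i k\<close>
  gain one exactly when \<open>j - i\<close> and the leading exponent of y in \<open>k\<close> add up to n+1.\<close>

lemma val_lcm:
  assumes v: "reduced (snd v)" and ij: "1 \<le> i" "i < j" "j \<le> n"
    and i: "val (gen_inv i v) \<ge> 0" and j: "val (gen_inv j v) \<ge> 0"
  shows "val (move False (int j - int i) (move True (- int j) v)) \<ge> 0"
proof -
  \<comment> \<open>The element to be tested is the quotient of v by \<rho>_j \<rho>_n^i = x^j
    y^(i-j). Everything is expressed through x^-j v, since x^-i v is x^(j-i) times it.\<close>
  obtain m l where k: "move True (- int j) v = (m, l)" by fastforce
  have l: "reduced l" using reduced_move[OF v, of True "- int j"] k by simp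
  have ki: "move True (- int i) v = move True (int j - int i) (m, l)"
    using v k move_move[of v True "int j - int i" "- int j"] by simp
  show ?thesis
  proof (cases "head_exp False l = 0")
    case True
    have "move False a (m, l) = (m, push False a l)" if "0 \<le> a" "a \<le> int n" for a
      using move_push[OF l True, of a m 0] that by (simp add: push_def)
    then show ?thesis
      using j ij k by (simp add: gen_inv_def val_def excess_push_False)
  next
    case False
    then have T: "head_exp True l = 0"
      by (auto simp: head_exp_def split: list.splits if_splits)
    obtain b t where *: "l = push False b t" "0 \<le> b" "b < int n + 1" "reduced t" "head_exp False t = 0"
      using l reduced_decompose[of l False] by (metis ord_simps(2))
    have b: "head_exp False l = b"
      using False * by (auto simp: push_def split: if_splits)
    define c where "c = int j - int i"
    have c: "0 < c" "c < int n" using ij by (auto simp: c_def)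
    have "move True c (m, l) = (m, (True, c) # l)"
      using move_push[OF l T, of c m 0] c by (simp add: push_def)
    moreover have "move False (int i) (m, (True, c) # l) = (m, (False, int i) # (True, c) # l)"
      using move_push[of "(True, c) # l" False "int i" m 0] c l T ij
      by (simp add: push_def)
    \<comment> \<open>The syllable y^i stands in front of x^c and completes no pair, so x^c y^b is
      the only new candidate.\<close>
    ultimately have "val (gen_inv i v) = m + (if c + b \<ge> int n + 1 then 1 else 0) + excess t"
      using b excess_push_False[of b t] *(1) by (simp add: gen_inv_def ki c_def val_def)
    moreover have "val (move False c (m, l)) = m + (b + c) div (int n + 1) + excess t"
      using move_push[of t False c m b] * by (simp add: val_def excess_push_False)
    moreover have "(b + c) div (int n + 1) = (if c + b \<ge> int n + 1 then 1 else 0)"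
    proof (cases "c + b \<ge> int n + 1")
      case True
      then show ?thesis
        using * c by (auto intro!: int_div_pos_eq[where r = "b + c - (int n + 1)"])
    qed (use * c in auto)
    ultimately show ?thesis using i k by (simp add: c_def)
  qed
qed

section \<open>Positive words acting on normal forms, their weight and their orbit\<close>

definition act :: "nat list \<Rightarrow> int \<times> (bool \<times> int) list \<Rightarrow> int \<times> (bool \<times> int) list" where
  "act w v = foldr gen w v"

lemma act_simps [simp]:
  "act [] v = v" "act (i # w) v = gen i (act w v)" "act (u @ w) v = act u (act w v)"
  by (simp_all add: act_def)

lemma reduced_act: "reduced (snd v) \<Longrightarrow> reduced (snd (act w v))"
  by (induction w) (auto simp: reduced_gen)

text \<open>The homomorphism to the integers with x \<mapsto> n+1, y \<mapsto> n and \<Delta>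
  \<mapsto> n(n+1); it sends \<rho>_i to i(n+1) - in = i.\<close>

definition weight :: "int \<times> (bool \<times> int) list \<Rightarrow> int" where
  "weight v = fst v * int n * (int n + 1)
     + (\<Sum>(s, a)\<leftarrow>snd v. a * (if s then int n + 1 else int n))"

lemma weight_push:
  "weight (m, push s c t) = m * int n * (int n + 1) + c * (if s then int n + 1 else int n) + weight (0, t)"
  by (simp add: weight_def push_def)

lemma weight_move:
  assumes "reduced (snd v)"
  shows "weight (move s a v) = weight v + a * (if s then int n + 1 else int n)"
proof -
  obtain c t where *: "snd v = push s c t" "reduced t" "head_exp s t = 0"
    using assms by (rule reduced_decompose)
  define q where "q = (if s then int n + 1 else int n)"
  have q: "int n * (int n + 1) = ord s * q" by (simp add: q_def ord_def)
  have "(c + a) div ord s * (ord s * q) + (c + a) mod ord s * q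
      = ((c + a) div ord s * ord s + (c + a) mod ord s) * q"
    by (simp only: distrib_right mult.assoc)
  then have "(c + a) div ord s * (ord s * q) + (c + a) mod ord s * q = (c + a) * q"
    by (simp only: div_mult_mod_eq)
  then have "weight (fst v + (c + a) div ord s, push s ((c + a) mod ord s) t)
      = weight (fst v, push s c t) + a * q"
    unfolding weight_push q_def[symmetric] mult.assoc q by (simp only: ring_distribs)
  then show ?thesis
    using * move_push[of t s a "fst v" c] by (cases v) (simp add: q_def)
qed

lemma weight_act: "weight (act w (0, [])) = int (sum_list w)"
proof (induction w)
  case (Cons i w)
  then show ?case
    by (simp add: gen_def weight_move reduced_move reduced_act algebra_simps)
qed (simp add: weight_def)

text \<open>The normal forms of the elements of the submonoid generated by the \<rho>_i; (0, []) is
  the identity.\<close>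

definition orbit :: "(int \<times> (bool \<times> int) list) set" where
  "orbit = (\<lambda>w. act w (0, [])) ` lists {1..n}"

lemma reduced_orbit: "v \<in> orbit \<Longrightarrow> reduced (snd v)"
  by (auto simp: orbit_def reduced_act)

lemma val_orbit: "v \<in> orbit \<Longrightarrow> val v \<ge> 0"
proof -
  have "val (act w (0, [])) \<ge> 0" if "w \<in> lists {1..n}" for w
    using that
  proof (induction w)
    case (Cons i w)
    then show ?case
      using val_gen_mono[of "act w (0, [])" i] by (simp add: reduced_act)
  qed (simp add: val_def)
  then show "v \<in> orbit \<Longrightarrow> ?thesis" by (auto simp: orbit_def)
qed

lemma gen_orbit: "v \<in> orbit \<Longrightarrow> 1 \<le> i \<Longrightarrow> i \<le> n \<Longrightarrow> gen i v \<in> orbit"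
proof -
  assume "v \<in> orbit" and i: "1 \<le> i" "i \<le> n"
  then obtain w where "w \<in> lists {1..n}" "v = act w (0, [])" by (auto simp: orbit_def)
  then show ?thesis unfolding orbit_def
    using i by (intro image_eqI[where x = "i # w"]) auto
qed

lemma move_False_orbit: "v \<in> orbit \<Longrightarrow> move False (int k) v \<in> orbit"
proof (induction k)
  case 0
  then show ?case by (simp add: move_0 reduced_orbit)
next
  case (Suc k)
  then have "gen n (move False (int k) v) \<in> orbit" using gen_orbit n_pos by simp
  then show ?case using Suc by (simp add: gen_n reduced_move reduced_orbit move_move)
qed

text \<open>x^a = \<rho>_a y^a, and y = \<rho>_n.\<close>

lemma move_True_orbit: 
  assumes "v \<in> orbit" "0 < a" "a \<le> int n"
  shows "move True a v \<in> orbit"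
proof -
  have "gen (nat a) (move False (int (nat a)) v) \<in> orbit"
    using assms by (intro gen_orbit move_False_orbit) auto
  then show ?thesis
    using assms by (simp add: gen_def reduced_move reduced_orbit move_move move_0)
qed

text \<open>Induction on the number of syllables. The empty list gives \<Delta>^m = y^(m(n+1)). A
  leading syllable that starts no counted pair is split off as a power of x or y, both in the
  submonoid. A counted pair is split off together with its hidden \<Delta>.\<close>

lemma orbit_if_val: "reduced l \<Longrightarrow> m + excess l \<ge> 0 \<Longrightarrow> (m, l) \<in> orbit"
proof (induction "length l" arbitrary: l m rule: less_induct)
  case less
  show ?case
  proof (cases l)
    case Nil
    have "(0, []) \<in> orbit"
      unfolding orbit_def by (intro image_eqI[where x = "[]"]) auto
    then have "move False (int (nat m * (n + 1))) (0, []) \<in> orbit" by (rule move_False_orbit)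
    moreover have "int (nat m * (n + 1)) = m * ord False"
      using less Nil by (simp add: algebra_simps)
    ultimately show ?thesis
      using move_ord[of "(0, [])" False m] Nil by (simp del: ord_simps)
  next
    case (Cons x t)
    obtain s a where l: "l = (s, a) # t" using Cons by (cases x) auto
    have a: "0 < a" "a < ord s" and t: "reduced t" "head_exp s t = 0"
      using less l by auto
    have mv: "move s a (m, t) = (m, l)"
      using move_push[OF t, of a m 0] a l by (simp add: push_def)
    show ?thesis
    proof (cases "s \<and> a + head_exp False t \<ge> int n + 1")
      case False
      then have "(m, t) \<in> orbit" using less l t by auto
      then show ?thesis
        using move_True_orbit[of "(m, t)" a] move_False_orbit[of "(m, t)" "nat a"] a mv
        by (cases s) auto
    next
      case True
      then have "head_exp False t > 0" using a by auto
      then obtain b t' where t': "t = (False, b) # t'"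
        by (auto simp: head_exp_def split: list.splits if_splits)
      \<comment> \<open>x^a y^b = \<rho>_a y^(a+b) = \<rho>_a y^c \<Delta>, so removing both
        syllables raises the exponent of \<Delta> to m + 1 and keeps \<open>val\<close>.\<close>
      define c where "c = a + b - (int n + 1)"
      have c: "c \<ge> 0" using True t' by (simp add: c_def)
      have "(m + 1, t') \<in> orbit" using less l t t' True by simp
      then have "gen (nat a) (move False (int (nat c)) (m + 1, t')) \<in> orbit"
        using a True by (intro gen_orbit move_False_orbit) auto
      moreover have "move False c (m + 1, t') = move False a (m, t)"
      proof -
        have r: "reduced t'" "head_exp False t' = 0" using t t' by auto
        have "(m + 1, t') = move False (int n + 1) (m, t')"
          using move_ord[of "(m, t')" False 1] r by simp
        moreover have "(m, t) = move False b (m, t')"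
          using move_push[OF r, of b m 0] t t' by (simp add: push_def)
        ultimately show ?thesis using r by (simp add: move_move c_def)
      qed
      ultimately have "move True a (m, t) \<in> orbit"
        using a c t by (simp add: gen_def move_move reduced_move move_0)
      then show ?thesis using mv True by simp
    qed
  qed
qed

end

section \<open>The monoid and its group of fractions\<close>

lemma Mn_rels_iff: "(p, q) \<in> Mn_rels n \<longleftrightarrow> (\<exists>i. 1 \<le> i \<and> i < n \<and> p = [1, n, i] \<and> q = [Suc i, n])"
  by (auto simp: Mn_rels_def)

lemma meq_relation:
  "1 \<le> i \<Longrightarrow> i < n \<Longrightarrow> equivclp (mstep (Mn_rels n)) ([1, n, i] @ w) ([Suc i, n] @ w)"
  using mstep.intros[of "[1, n, i]" "[Suc i, n]" "Mn_rels n" "[]" w]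
  by (auto simp: Mn_rels_iff intro: r_into_equivclp)

text \<open>For i = 1 this is a defining relation. The step rewrites \<rho>_(i+1) \<rho>_n to
  \<rho>_1 \<rho>_n \<rho>_i, applies the hypothesis to i and j - 1, and returns by \<rho>_1
  \<rho>_n \<rho>_(j-1) = \<rho>_j \<rho>_n.\<close>

lemma meq_lcm:
  assumes "1 \<le> i" "i < j" "j \<le> n"
  shows "equivclp (mstep (Mn_rels n)) (i # replicate i n @ [j - i]) (j # replicate i n)"
  using assms
proof (induction i arbitrary: j)
  case (Suc i)
  show ?case
  proof (cases "i = 0")
    case True
    then show ?thesis using meq_relation[of "j - 1" n "[]"] Suc.prems by simp
  next
    case False
    have "equivclp (mstep (Mn_rels n)) (Suc i # replicate (Suc i) n @ [j - Suc i])
        ([1, n] @ (i # replicate i n @ [j - 1 - i]))"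
      using meq_relation[of i n "replicate i n @ [j - 1 - i]"] False Suc.prems
      by (simp add: equivclp_sym)
    moreover have "equivclp (mstep (Mn_rels n)) ([1, n] @ (i # replicate i n @ [j - 1 - i]))
        ([1, n] @ ((j - 1) # replicate i n))"
      using Suc.IH[of "j - 1"] Suc.prems False by (intro meq_append) auto
    moreover have "equivclp (mstep (Mn_rels n)) ([1, n] @ ((j - 1) # replicate i n))
        (j # replicate (Suc i) n)"
      using meq_relation[of "j - 1" n "replicate i n"] Suc.prems by simp
    ultimately show ?thesis by (meson equivclp_trans)
  qed
qed simp

text \<open>Both sides of a relation have letter sum n + i + 1.\<close>

lemma meq_sum_list: "equivclp (mstep (Mn_rels n)) u v \<Longrightarrow> sum_list u = sum_list v"
  by (erule equivclp_invariant) (auto elim!: mstep.cases simp: Mn_rels_iff)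

section \<open>Faithfulness of the action and injectivity into the group\<close>

context torus_normal_forms
begin

definition signed_act :: "(nat \<times> bool) list \<Rightarrow> int \<times> (bool \<times> int) list \<Rightarrow> int \<times> (bool \<times> int) list"
  where "signed_act w v = foldr (\<lambda>(i, b). if b then gen i else gen_inv i) w v"

lemma signed_act_simps [simp]:
  "signed_act [] v = v"
  "signed_act ((i, b) # w) v = (if b then gen i else gen_inv i) (signed_act w v)"
  "signed_act (u @ w) v = signed_act u (signed_act w v)"
  by (simp_all add: signed_act_def)

lemma signed_act_pos_word: "signed_act (pos_word w) v = act w v"
  by (induction w) auto

lemma reduced_signed_act: "reduced (snd v) \<Longrightarrow> reduced (snd (signed_act w v))"
  by (induction w) (auto simp: reduced_gen reduced_gen_inv)

text \<open>Intermediate words may contain any natural number as a letter; \<open>gen i\<close> and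
  \<open>gen_inv i\<close> are inverse to each other on reduced states for every i, so such letters
  do no harm.\<close>

lemma signed_act_geq:
  assumes "equivclp (gstep (Mn_rels n)) u w" and v: "reduced (snd v)"
  shows "signed_act u v = signed_act w v"
  using assms(1)
proof (rule equivclp_invariant)
  fix a b assume "gstep (Mn_rels n) a b"
  then show "signed_act a v = signed_act b v"
  proof cases
    case (cancel u x c w)
    then show ?thesis
      using v by (cases c) (simp_all add: gen_gen_inv gen_inv_gen reduced_signed_act)
  next
    case (rel p q u w)
    then show ?thesis
      using gen_relation[OF reduced_signed_act[OF v]] by (auto simp: Mn_rels_iff)
  qed
qed

lemma act_meq:
  "equivclp (mstep (Mn_rels n)) u w \<Longrightarrow> reduced (snd v) \<Longrightarrow> act u v = act w v"
  using signed_act_geq[OF meq_imp_geq] by (simp add: signed_act_pos_word)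

lemma act_replicate_n: "reduced (snd v) \<Longrightarrow> act (replicate k n) v = move False (int k) v"
  by (induction k) (simp_all add: move_0 gen_n reduced_move move_move)

text \<open>With v = \<rho>_i u = \<rho>_j w, the criterion puts k = y^(j-i) x^-j v in the
  submonoid, so a positive word c represents it and v = \<rho>_j \<rho>_n^i c.\<close>

lemma act_lcm:
  assumes ij: "1 \<le> i" "i < j" "j \<le> n" and uw: "u \<in> lists {1..n}" "w \<in> lists {1..n}"
    and eq: "act (i # u) (0, []) = act (j # w) (0, [])"
  obtains c where "c \<in> lists {1..n}"
    "act u (0, []) = act (replicate i n @ [j - i] @ c) (0, [])"
    "act w (0, []) = act (replicate i n @ c) (0, [])"
proof -
  define v where "v = act (i # u) (0, [])"
  have v: "reduced (snd v)" by (simp add: v_def reduced_gen reduced_act)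
  have i: "gen_inv i v = act u (0, [])" by (simp add: v_def gen_inv_gen reduced_act)
  have j: "gen_inv j v = act w (0, [])"
    unfolding v_def eq by (simp add: gen_inv_gen reduced_act)
  define k where "k = move False (int j - int i) (move True (- int j) v)"
  have k: "reduced (snd k)" using v by (simp add: k_def reduced_move)
  have "gen_inv i v \<in> orbit" "gen_inv j v \<in> orbit"
    using uw by (auto simp: i j orbit_def)
  then have "val k \<ge> 0"
    unfolding k_def using val_lcm[OF v ij] val_orbit by blast
  then have "k \<in> orbit"
    using orbit_if_val[OF k, of "fst k"] by (simp add: val_def)
  then obtain c where c: "c \<in> lists {1..n}" "act c (0, []) = k" by (auto simp: orbit_def)
  \<comment> \<open>y^i k = y^j x^-j v, which is v with \<rho>_j removed.\<close>
  have "act (replicate i n @ c) (0, []) = gen_inv j v"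
    using k v c ij by (simp add: act_replicate_n) (simp add: k_def gen_inv_def move_move reduced_move)
  \<comment> \<open>\<rho>_(j-i) cancels the factor y^(j-i) of k and turns x^-j into x^-i.\<close>
  moreover have "gen (j - i) k = move True (- int i) v"
    using v ij by (simp add: gen_def k_def move_move reduced_move move_0 of_nat_diff)
  then have "act (replicate i n @ [j - i] @ c) (0, []) = gen_inv i v"
    using k v c ij by (simp add: act_replicate_n reduced_move gen_inv_def)
  ultimately show thesis using that c i j by simp
qed

text \<open>Induction on the weight. Equal first letters cancel in the group. For first letters i <
  j, \<open>act_lcm\<close> gives normal forms for the two tails, which the induction hypothesis
  turns into equalities of the monoid; \<open>meq_lcm\<close> then joins the two words.\<close>

lemma act_faithful:
  assumes "u \<in> lists {1..n}" "w \<in> lists {1..n}" "act u (0, []) = act w (0, [])"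
  shows "equivclp (mstep (Mn_rels n)) u w"
  using assms
proof (induction "sum_list u" arbitrary: u w rule: less_induct)
  case less
  \<comment> \<open>Tied to \<open>u\<close> only through its weight, this serves for both orders of
    the two first letters.\<close>
  have step: "equivclp (mstep (Mn_rels n)) (i # u') (j # w')"
    if sum: "sum_list (i # u') = sum_list u"
      and in_lists: "i # u' \<in> lists {1..n}" "j # w' \<in> lists {1..n}"
      and eq: "act (i # u') (0, []) = act (j # w') (0, [])" and "i < j" for i j u' w'
  proof -
    have ij: "1 \<le> i" "j \<le> n" and uw: "u' \<in> lists {1..n}" "w' \<in> lists {1..n}"
      using in_lists by auto
    obtain c where c: "c \<in> lists {1..n}"
      "act u' (0, []) = act (replicate i n @ [j - i] @ c) (0, [])"
      "act w' (0, []) = act (replicate i n @ c) (0, [])"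
      using act_lcm[OF ij(1) \<open>i < j\<close> ij(2) uw eq] .
    have "sum_list (j # w') = sum_list (i # u')"
      using eq weight_act[of "i # u'"] weight_act[of "j # w'"] by simp
    then have less': "sum_list u' < sum_list u" "sum_list w' < sum_list u"
      using sum ij \<open>i < j\<close> by auto
    have u': "equivclp (mstep (Mn_rels n)) u' (replicate i n @ [j - i] @ c)"
      using ij \<open>i < j\<close> uw c by (intro less.hyps less') auto
    have w': "equivclp (mstep (Mn_rels n)) w' (replicate i n @ c)"
      using ij \<open>i < j\<close> uw c by (intro less.hyps less') auto
    have "equivclp (mstep (Mn_rels n)) (i # u') ((i # replicate i n @ [j - i]) @ c)"
      using meq_append[OF _ u', of "[i]" "[i]"] by simp
    moreover have "equivclp (mstep (Mn_rels n)) ((i # replicate i n @ [j - i]) @ c) ((j # replicate i n) @ c)"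
      using ij \<open>i < j\<close> by (intro meq_append meq_lcm) auto
    moreover have "equivclp (mstep (Mn_rels n)) (j # w') ((j # replicate i n) @ c)"
      using meq_append[OF _ w', of "[j]" "[j]"] by simp
    ultimately show ?thesis by (meson equivclp_trans equivclp_sym)
  qed
  have sums: "sum_list u = sum_list w"
    using less.prems(3) weight_act[of u] weight_act[of w] by simp
  have nonzero: "sum_list x > 0" if "x \<in> lists {1..n}" "x \<noteq> []" for x
    using that by (cases x) auto
  show ?case
  proof (cases u)
    case Nil
    then have "w = []" using nonzero[OF less.prems(2)] sums by (metis less_irrefl sum_list.Nil)
    then show ?thesis using Nil by simp
  next
    case u: (Cons i u')
    then have "w \<noteq> []" using nonzero[of u] less.prems sums by auto
    then obtain j w' where w: "w = j # w'" by (cases w) auto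
    consider "i < j" | "j < i" | "i = j" by linarith
    then show ?thesis
    proof cases
      case 1
      then show ?thesis using step[of i u' j w'] less.prems u w by simp
    next
      case 2
      then show ?thesis
        using step[of j w' i u'] less.prems u w sums by (simp add: equivclp_sym)
    next
      case 3
      have "act u' (0, []) = act w' (0, [])"
        using less.prems(3) gen_inv_gen[of "act u' (0, [])" i] gen_inv_gen[of "act w' (0, [])" i]
        by (simp add: u w 3 reduced_act)
      then have "equivclp (mstep (Mn_rels n)) u' w'"
        using less.prems u w by (intro less.hyps) auto
      then show ?thesis
        using meq_append[of "Mn_rels n" "[i]" "[i]" u' w'] by (simp add: u w 3)
    qed
  qed
qed

text \<open>\<Delta> acts as y^(n+1), which commutes with powers of y, and equally as x^n, which
  commutes with powers of x.\<close>

lemma act_Delta_commute: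
  assumes "reduced (snd v)"
  shows "act (replicate (n + 1) n) (act w v) = act w (act (replicate (n + 1) n) v)"
proof -
  have "move False (int n + 1) (gen i v) = gen i (move False (int n + 1) v)"
    if v: "reduced (snd v)" for i v
  proof -
    define z where "z = move False (- int i) v"
    have z: "reduced (snd z)" using v by (simp add: z_def reduced_move)
    have "gen i (move False (int n + 1) v) = move True (int i) (move False (int n + 1) z)"
      using v by (simp add: gen_def z_def move_move add.commute)
    also have "\<dots> = move True (int n) (gen i v)"
      unfolding move_True_n[OF z, symmetric] using z
      by (simp add: gen_def move_move add.commute flip: z_def)
    finally show ?thesis using v by (simp add: move_True_n reduced_gen)
  qed
  then have "move False (int n + 1) (act w v) = act w (move False (int n + 1) v)"
    using reduced_act[OF assms] by (induction w) (simp, metis act_simps(2))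
  then show ?thesis
    using act_replicate_n[of v "n + 1"] act_replicate_n[of "act w v" "n + 1"] assms
    by (simp add: reduced_act add.commute del: replicate_Suc)
qed

text \<open>The complement is y^i x^(n-i), since \<rho>_i y^i x^(n-i) = x^n = \<Delta>.\<close>

lemma gen_divides_Delta:
  assumes "1 \<le> i" "i \<le> n"
  obtains w where "w \<in> lists {1..n}"
    "equivclp (mstep (Mn_rels n)) (i # w) (replicate (n + 1) n)"
proof -
  define v where "v = move False (int i) (move True (int n - int i) (0, []))"
  have "(0, []) \<in> orbit"
    unfolding orbit_def by (intro image_eqI[where x = "[]"]) auto
  \<comment> \<open>For i = n the power of x is trivial, while \<open>move_True_orbit\<close> asks
    for a positive exponent.\<close>
  then have "move True (int n - int i) (0, []) \<in> orbit"
    using move_True_orbit[of "(0, [])" "int n - int i"] assms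
    by (cases "i = n") (auto simp: move_0)
  then have "v \<in> orbit" unfolding v_def by (rule move_False_orbit)
  then obtain w where w: "w \<in> lists {1..n}" "act w (0, []) = v" by (auto simp: orbit_def)
  have "act (i # w) (0, []) = move True (int n) (0, [])"
    by (simp add: w v_def gen_def move_move reduced_move move_0)
  also have "\<dots> = act (replicate (n + 1) n) (0, [])"
    using act_replicate_n[of "(0, [])" "n + 1"]
    by (simp add: move_True_n add.commute del: replicate_Suc)
  finally have "equivclp (mstep (Mn_rels n)) (i # w) (replicate (n + 1) n)"
    using assms w n_pos by (intro act_faithful) auto
  then show thesis using that w by blast
qed

lemma inj_canon: "inj_on (canon {1..n} (Mn_rels n)) (carrier (Mn n))"
proof (rule inj_onI)
  fix X Y assume "X \<in> carrier (Mn n)" "Y \<in> carrier (Mn n)"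
    and eq: "canon {1..n} (Mn_rels n) X = canon {1..n} (Mn_rels n) Y"
  then obtain u w where u: "u \<in> lists {1..n}" "X = mclass {1..n} (Mn_rels n) u"
    and w: "w \<in> lists {1..n}" "Y = mclass {1..n} (Mn_rels n) w"
    by (auto simp: Mn_def carrier_pres_monoid)
  have "equivclp (gstep (Mn_rels n)) (pos_word u) (pos_word w)"
    using eq u w by (simp add: canon_mclass gclass_eq_iff pos_word_in_lists)
  from signed_act_geq[OF this, of "(0, [])"] show "X = Y"
    using u w by (simp add: signed_act_pos_word act_faithful mclass_eq_iff)
qed

section \<open>Verification of the Garside hypotheses for M_n\<close>

definition elt :: "nat list \<Rightarrow> nat list set" where
  "elt = mclass {1..n} (Mn_rels n)"

lemma carrier_Mn: "carrier (Mn n) = elt ` lists {1..n}"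
  by (simp add: Mn_def carrier_pres_monoid elt_def)

lemma elt_closed: "w \<in> lists {1..n} \<Longrightarrow> elt w \<in> carrier (Mn n)"
  by (simp add: carrier_Mn)

lemma one_Mn: "\<one>\<^bsub>Mn n\<^esub> = elt []"
  by (simp add: Mn_def one_pres_monoid elt_def)

lemma elt_mult:
  "u \<in> lists {1..n} \<Longrightarrow> w \<in> lists {1..n} \<Longrightarrow> elt u \<otimes>\<^bsub>Mn n\<^esub> elt w = elt (u @ w)"
  by (simp add: Mn_def mclass_mult elt_def)

lemma elt_eq_iff: "w \<in> lists {1..n} \<Longrightarrow> elt u = elt w \<longleftrightarrow> equivclp (mstep (Mn_rels n)) u w"
  by (simp add: mclass_eq_iff elt_def)

lemma Delta_word: "replicate (n + 1) n \<in> lists {1..n}"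
  using n_pos by auto

text \<open>\<open>meq_lcm\<close> makes the element a common multiple. It is least because
  \<open>act_lcm\<close> factors any other one through it on normal forms, and
  \<open>act_faithful\<close> carries this factorization back to the monoid.\<close>

lemma elt_lcm:
  assumes ij: "1 \<le> i" "i < j" "j \<le> n"
  shows "is_lcm_wrt (Mn n) (ldvd (Mn n)) (elt [i]) (elt [j]) (elt (j # replicate i n))"
  unfolding is_lcm_wrt_def
proof (intro conjI ballI impI)
  have r: "replicate i n \<in> lists {1..n}" using n_pos by auto
  show "elt (j # replicate i n) \<in> carrier (Mn n)"
    using r ij by (intro elt_closed) auto
  have "elt (j # replicate i n) = elt (i # replicate i n @ [j - i])"
    using meq_lcm[OF ij] r ij by (intro sym[OF iffD2[OF elt_eq_iff]]) auto
  moreover have "[i] \<in> lists {1..n}" "replicate i n @ [j - i] \<in> lists {1..n}" using r ij by auto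
  ultimately show "ldvd (Mn n) (elt [i]) (elt (j # replicate i n))"
    by (intro ldvdI[of "elt (replicate i n @ [j - i])"]) (simp_all add: elt_closed elt_mult)
  show "ldvd (Mn n) (elt [j]) (elt (j # replicate i n))"
    using r ij by (intro ldvdI[of "elt (replicate i n)"]) (simp_all add: elt_closed elt_mult)
  fix d assume "ldvd (Mn n) (elt [i]) d \<and> ldvd (Mn n) (elt [j]) d"
  then obtain u w where uw: "u \<in> lists {1..n}" "w \<in> lists {1..n}"
    "d = elt [i] \<otimes>\<^bsub>Mn n\<^esub> elt u" "d = elt [j] \<otimes>\<^bsub>Mn n\<^esub> elt w"
    unfolding ldvd_def carrier_Mn by blast
  then have d: "d = elt (i # u)" "d = elt (j # w)" using ij by (simp_all add: elt_mult)
  then have "equivclp (mstep (Mn_rels n)) (i # u) (j # w)"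
    using uw ij elt_eq_iff[of "j # w" "i # u"] by auto
  then have "act (i # u) (0, []) = act (j # w) (0, [])" by (rule act_meq) simp
  then obtain c where c: "c \<in> lists {1..n}" "act w (0, []) = act (replicate i n @ c) (0, [])"
    using act_lcm[OF ij uw(1,2)] by metis
  then have "equivclp (mstep (Mn_rels n)) w (replicate i n @ c)"
    using uw r by (intro act_faithful) auto
  then have "elt w = elt (replicate i n @ c)"
    using c r by (subst elt_eq_iff) auto
  then have "d = elt [j] \<otimes>\<^bsub>Mn n\<^esub> elt (replicate i n @ c)"
    using uw by simp
  also have "\<dots> = elt (j # replicate i n) \<otimes>\<^bsub>Mn n\<^esub> elt c"
    using r c ij by (subst (1 2) elt_mult) auto
  finally show "ldvd (Mn n) (elt (j # replicate i n)) d"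
    using elt_closed[OF c(1)] by (auto intro: ldvdI)
qed

lemma monoid_Mn: "monoid (Mn n)"
  by (simp add: Mn_def monoid_pres_monoid)

lemma group_Gn: "group (Gn n)"
  by (simp add: Gn_def group_pres_group)

lemma canon_hom_Gn: "canon {1..n} (Mn_rels n) \<in> hom (Mn n) (Gn n)"
  by (simp add: Mn_def Gn_def canon_hom)

lemma Mn_cancel:
  assumes "a \<in> carrier (Mn n)" "b \<in> carrier (Mn n)" "c \<in> carrier (Mn n)"
  shows "a \<otimes>\<^bsub>Mn n\<^esub> b = a \<otimes>\<^bsub>Mn n\<^esub> c \<Longrightarrow> b = c"
    and "b \<otimes>\<^bsub>Mn n\<^esub> a = c \<otimes>\<^bsub>Mn n\<^esub> a \<Longrightarrow> b = c"
proof -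
  define \<phi> where "\<phi> = canon {1..n} (Mn_rels n)"
  interpret G: group "Gn n" by (rule group_Gn)
  note mult = hom_mult[OF canon_hom_Gn, folded \<phi>_def]
    and cl = hom_in_carrier[OF canon_hom_Gn, folded \<phi>_def]
  have inj: "\<phi> b = \<phi> c \<Longrightarrow> b = c"
    using inj_onD[OF inj_canon] assms unfolding \<phi>_def by blast
  show "b = c" if "a \<otimes>\<^bsub>Mn n\<^esub> b = a \<otimes>\<^bsub>Mn n\<^esub> c"
    using arg_cong[OF that, of \<phi>] assms by (intro inj) (simp add: mult cl)
  show "b = c" if "b \<otimes>\<^bsub>Mn n\<^esub> a = c \<otimes>\<^bsub>Mn n\<^esub> a"
    using arg_cong[OF that, of \<phi>] assms by (intro inj) (simp add: mult cl)
qed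

lemma Delta_n_elt: "Delta_n n = elt (replicate (n + 1) n)"
  by (simp add: Delta_n_def elt_def)

lemma Delta_n_central:
  assumes "a \<in> carrier (Mn n)"
  shows "a \<otimes>\<^bsub>Mn n\<^esub> Delta_n n = Delta_n n \<otimes>\<^bsub>Mn n\<^esub> a"
proof -
  obtain w where w: "w \<in> lists {1..n}" "a = elt w" using assms by (auto simp: carrier_Mn)
  have "equivclp (mstep (Mn_rels n)) (w @ replicate (n + 1) n) (replicate (n + 1) n @ w)"
    using w Delta_word act_Delta_commute[of "(0, [])" w] by (intro act_faithful) auto
  then have "elt (w @ replicate (n + 1) n) = elt (replicate (n + 1) n @ w)"
    using w Delta_word by (subst elt_eq_iff) auto
  then show ?thesis
    using w Delta_word by (simp add: Delta_n_elt elt_mult del: replicate_Suc)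
qed

lemma gen_ldvd_Delta_n:
  assumes "i \<in> {1..n}"
  shows "ldvd (Mn n) (elt [i]) (Delta_n n)"
proof -
  obtain w where w: "w \<in> lists {1..n}" "equivclp (mstep (Mn_rels n)) (i # w) (replicate (n + 1) n)"
    using gen_divides_Delta[of i] assms by auto
  then have "elt (i # w) = Delta_n n"
    using elt_eq_iff[OF Delta_word] by (simp add: Delta_n_elt del: replicate_Suc)
  then have "Delta_n n = elt [i] \<otimes>\<^bsub>Mn n\<^esub> elt w"
    using assms w by (simp add: elt_mult)
  then show ?thesis using w elt_closed by (auto intro: ldvdI)
qed

definition wt :: "nat list set \<Rightarrow> nat" where
  "wt X = sum_list (SOME w. w \<in> X)"

lemma wt_elt: "w \<in> lists {1..n} \<Longrightarrow> wt (elt w) = sum_list w"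
proof -
  assume "w \<in> lists {1..n}"
  then have "w \<in> elt w" by (simp add: elt_def mclass_def)
  then have "(SOME w'. w' \<in> elt w) \<in> elt w" by (rule someI)
  then show ?thesis
    using meq_sum_list[of n w "SOME w'. w' \<in> elt w"] by (simp add: wt_def elt_def mclass_def)
qed

lemma atomic_lcm_monoid_Mn:
  "atomic_lcm_monoid (Mn n) ((\<lambda>i. elt [i]) ` {1..n}) wt (Delta_n n)"
proof (intro atomic_lcm_monoid.intro atomic_lcm_monoid_axioms.intro)
  show "monoid (Mn n)" by (rule monoid_Mn)
  show "wt (a \<otimes>\<^bsub>Mn n\<^esub> b) = wt a + wt b" if "a \<in> carrier (Mn n)" "b \<in> carrier (Mn n)" for a b
  proof -
    obtain u w where uw: "u \<in> lists {1..n}" "w \<in> lists {1..n}" "a = elt u" "b = elt w"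
      using \<open>a \<in> _\<close> \<open>b \<in> _\<close> by (auto simp: carrier_Mn)
    then show ?thesis by (simp add: elt_mult wt_elt)
  qed
  show "\<exists>xs. set xs \<subseteq> (\<lambda>i. elt [i]) ` {1..n} \<and> a = foldr (\<otimes>\<^bsub>Mn n\<^esub>) xs \<one>\<^bsub>Mn n\<^esub>"
    if "a \<in> carrier (Mn n)" for a
  proof -
    obtain w where w: "w \<in> lists {1..n}" "a = elt w" using \<open>a \<in> _\<close> by (auto simp: carrier_Mn)
    have "foldr (\<otimes>\<^bsub>Mn n\<^esub>) (map (\<lambda>i. elt [i]) w) \<one>\<^bsub>Mn n\<^esub> = elt w"
      using w(1) by (induction w) (auto simp: one_Mn elt_mult)
    then show ?thesis using w by (intro exI[of _ "map (\<lambda>i. elt [i]) w"]) auto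
  qed
  show "\<exists>c. is_lcm_wrt (Mn n) (ldvd (Mn n)) s t c"
    if "s \<in> (\<lambda>i. elt [i]) ` {1..n}" "t \<in> (\<lambda>i. elt [i]) ` {1..n}" for s t
  proof -
    obtain i j where ij: "i \<in> {1..n}" "s = elt [i]" "j \<in> {1..n}" "t = elt [j]" using \<open>s \<in> _\<close> \<open>t \<in> _\<close> by auto
    consider "i < j" | "j < i" | "i = j" by linarith
    then show ?thesis
    proof cases
      case 1
      then show ?thesis using elt_lcm[of i j] ij by auto
    next
      case 2
      then show ?thesis using elt_lcm[of j i] ij by (auto simp: is_lcm_wrt_def)
    next
      case 3
      have "ldvd (Mn n) s s"
        by (rule ldvdI[of "elt []"]) (use ij in \<open>simp_all add: elt_mult elt_closed\<close>)
      then show ?thesis using 3 ij elt_closed[of "[i]"] by (auto simp: is_lcm_wrt_def)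
    qed
  qed
  show "(\<lambda>i. elt [i]) ` {1..n} \<subseteq> carrier (Mn n)" by (auto intro: elt_closed)
  show "Delta_n n \<in> carrier (Mn n)" unfolding Delta_n_elt by (rule elt_closed[OF Delta_word])
  show "b = c" if "a \<otimes>\<^bsub>Mn n\<^esub> b = a \<otimes>\<^bsub>Mn n\<^esub> c"
    "a \<in> carrier (Mn n)" "b \<in> carrier (Mn n)" "c \<in> carrier (Mn n)" for a b c
    using Mn_cancel(1) that by blast
  show "b = c" if "b \<otimes>\<^bsub>Mn n\<^esub> a = c \<otimes>\<^bsub>Mn n\<^esub> a"
    "a \<in> carrier (Mn n)" "b \<in> carrier (Mn n)" "c \<in> carrier (Mn n)" for a b c
    using Mn_cancel(2) that by blast
qed (auto simp: wt_elt Delta_n_central gen_ldvd_Delta_n)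

text \<open>A positive generator is absorbed by the numerator. For an inverse write \<Delta> =
  \<rho>_i t; centrality gives \<rho>_i^-1 a b^-1 = t \<Delta>^-1 a b^-1 = (t a)(b
  \<Delta>)^-1.\<close>

lemma Gn_fraction:
  assumes "g \<in> carrier (Gn n)"
  shows "\<exists>a\<in>carrier (Mn n). \<exists>b\<in>carrier (Mn n).
    g = canon {1..n} (Mn_rels n) a \<otimes>\<^bsub>Gn n\<^esub> inv\<^bsub>Gn n\<^esub> canon {1..n} (Mn_rels n) b"
proof -
  define \<phi> where "\<phi> = canon {1..n} (Mn_rels n)"
  define cls where "cls = gclass {1..n} (Mn_rels n)"
  interpret M: monoid "Mn n" by (rule monoid_Mn)
  interpret G: group "Gn n" by (rule group_Gn)
  note mult = hom_mult[OF canon_hom_Gn, folded \<phi>_def]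
    and cl [simp] = hom_in_carrier[OF canon_hom_Gn, folded \<phi>_def]
  have gen: "cls [(i, True)] = \<phi> (elt [i])" if "i \<in> {1..n}" for i
    using that by (simp add: elt_def canon_mclass cls_def \<phi>_def)
  have gen_closed [simp]: "elt [i] \<in> carrier (Mn n)" if "i \<in> {1..n}" for i
    using that by (intro elt_closed) auto
  have D [simp]: "Delta_n n \<in> carrier (Mn n)"
    unfolding Delta_n_elt by (rule elt_closed[OF Delta_word])
  obtain w where w: "w \<in> lists ({1..n} \<times> UNIV)" "g = cls w"
    using assms by (auto simp: Gn_def carrier_pres_group cls_def)
  have "\<exists>a\<in>carrier (Mn n). \<exists>b\<in>carrier (Mn n).
    cls w = \<phi> a \<otimes>\<^bsub>Gn n\<^esub> inv\<^bsub>Gn n\<^esub> \<phi> b"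
    using w(1) unfolding cls_def
  proof (induction rule: gclass_induct)
    case one
    have "cls [] = \<one>\<^bsub>Gn n\<^esub>"
      by (simp add: Gn_def one_pres_group cls_def)
    then have "cls [] =
        \<phi> \<one>\<^bsub>Mn n\<^esub> \<otimes>\<^bsub>Gn n\<^esub> inv\<^bsub>Gn n\<^esub> \<phi> \<one>\<^bsub>Mn n\<^esub>" by simp
    then show ?case unfolding cls_def by blast
  next
    case (pos i x)
    then obtain a b where ab: "a \<in> carrier (Mn n)" "b \<in> carrier (Mn n)"
      "x = \<phi> a \<otimes>\<^bsub>Gn n\<^esub> inv\<^bsub>Gn n\<^esub> \<phi> b" by auto
    have "\<phi> (elt [i]) \<otimes>\<^bsub>Gn n\<^esub> x
        = \<phi> (elt [i] \<otimes>\<^bsub>Mn n\<^esub> a) \<otimes>\<^bsub>Gn n\<^esub> inv\<^bsub>Gn n\<^esub> \<phi> b"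
      using ab pos(1) by (simp add: mult G.m_assoc)
    then show ?case
      using ab pos(1) gen by (metis Gn_def M.m_closed gen_closed cls_def)
  next
    case (neg i x)
    then obtain a b where ab: "a \<in> carrier (Mn n)" "b \<in> carrier (Mn n)"
      "x = \<phi> a \<otimes>\<^bsub>Gn n\<^esub> inv\<^bsub>Gn n\<^esub> \<phi> b" by auto
    let ?r = "\<phi> (elt [i])" and ?d = "\<phi> (Delta_n n)"
    obtain t where t: "t \<in> carrier (Mn n)" "Delta_n n = elt [i] \<otimes>\<^bsub>Mn n\<^esub> t"
      using gen_ldvd_Delta_n neg(1) by (auto simp: ldvd_def)
    have r: "?r \<in> carrier (Gn n)" using neg(1) by simp
    have rt: "?r \<otimes>\<^bsub>Gn n\<^esub> \<phi> t = ?d"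
      using t neg(1) by (simp add: mult)
    have da: "?d \<otimes>\<^bsub>Gn n\<^esub> \<phi> a = \<phi> a \<otimes>\<^bsub>Gn n\<^esub> ?d"
      using Delta_n_central[OF ab(1)] ab by (simp flip: mult)
    let ?y = "\<phi> (t \<otimes>\<^bsub>Mn n\<^esub> a) \<otimes>\<^bsub>Gn n\<^esub> inv\<^bsub>Gn n\<^esub> \<phi> (b \<otimes>\<^bsub>Mn n\<^esub> Delta_n n)"
    have "?r \<otimes>\<^bsub>Gn n\<^esub> ?y = (?r \<otimes>\<^bsub>Gn n\<^esub> \<phi> t) \<otimes>\<^bsub>Gn n\<^esub> \<phi> a
        \<otimes>\<^bsub>Gn n\<^esub> (inv\<^bsub>Gn n\<^esub> ?d \<otimes>\<^bsub>Gn n\<^esub> inv\<^bsub>Gn n\<^esub> \<phi> b)"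
      using ab(1,2) t(1) r by (simp add: mult G.inv_mult_group G.m_assoc)
    also have "\<dots> = \<phi> a \<otimes>\<^bsub>Gn n\<^esub> (?d \<otimes>\<^bsub>Gn n\<^esub> inv\<^bsub>Gn n\<^esub> ?d) \<otimes>\<^bsub>Gn n\<^esub> inv\<^bsub>Gn n\<^esub> \<phi> b"
      unfolding rt da using ab(1,2) cl[OF D] by (simp only: G.m_assoc G.inv_closed G.m_closed cl)
    also have "\<dots> = x" using ab cl[OF D] by simp
    finally have "inv\<^bsub>Gn n\<^esub> ?r \<otimes>\<^bsub>Gn n\<^esub> x = ?y"
      using ab(1,2) t(1) r by (intro G.inv_solve_left'[THEN iffD2]) auto
    then show ?case
      using ab t(1) neg(1) gen by (metis Gn_def M.m_closed D cls_def)
  qed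
  then show ?thesis using w by (simp add: \<phi>_def)
qed

end

section \<open>The isomorphism with the torus knot group\<close>

lemma (in group) word_value_replicate:
  assumes "range f \<subseteq> carrier G"
  shows "word_value G f (pos_word (replicate k g)) = f g [^] k"
  using assms
proof (induction k)
  case (Suc k)
  have "f g \<in> carrier G" using assms by auto
  then have "f g [^] Suc k = f g \<otimes> f g [^] k" by (rule nat_pow_Suc2)
  with Suc show ?case by (simp del: nat_pow_Suc)
qed simp

text \<open>The first identity is \<rho>_n = y for \<rho>_i = x^i y^-i. The second is the defining
  relation of M_n, since x y^-1 y x^i y^-i = x^(i+1) y^-(i+1) y.\<close>

lemma (in group) torus_relation:
  assumes "x \<in> carrier G" "y \<in> carrier G" "x [^] n = y [^] Suc n"
  shows "x [^] n \<otimes> inv (y [^] n) = y"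
    and "x [^] (1::nat) \<otimes> inv (y [^] (1::nat)) \<otimes> (x [^] n \<otimes> inv (y [^] n) \<otimes> (x [^] i \<otimes> inv (y [^] i)))
      = x [^] Suc i \<otimes> inv (y [^] Suc i) \<otimes> (x [^] n \<otimes> inv (y [^] n))"
proof -
  have "y [^] Suc n = y \<otimes> y [^] n" using assms by (rule_tac nat_pow_Suc2)
  then show y: "x [^] n \<otimes> inv (y [^] n) = y"
    using assms by (simp add: m_assoc del: nat_pow_Suc)
  have 1: "x [^] Suc i = x \<otimes> x [^] i" "y [^] Suc i = y \<otimes> y [^] i"
    using assms by (simp_all only: nat_pow_Suc2)
  have "x \<otimes> inv y \<otimes> (y \<otimes> (x [^] i \<otimes> inv (y [^] i))) = x \<otimes> (inv y \<otimes> y) \<otimes> (x [^] i \<otimes> inv (y [^] i))"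
    using assms(1,2) by (simp only: m_assoc inv_closed nat_pow_closed m_closed)
  also have "\<dots> = x \<otimes> x [^] i \<otimes> inv (y [^] i) \<otimes> (inv y \<otimes> y)"
    using assms by (simp add: m_assoc)
  also have "\<dots> = x [^] Suc i \<otimes> inv (y [^] Suc i) \<otimes> y"
    unfolding 1 using assms by (simp add: m_assoc inv_mult_group del: l_inv)
  finally show "x [^] (1::nat) \<otimes> inv (y [^] (1::nat)) \<otimes> (x [^] n \<otimes> inv (y [^] n) \<otimes> (x [^] i \<otimes> inv (y [^] i)))
      = x [^] Suc i \<otimes> inv (y [^] Suc i) \<otimes> (x [^] n \<otimes> inv (y [^] n))"
    unfolding y using assms by simp
qed

text \<open>Recovers x^i = \<rho>_i y^i from the relations of M_n, with x = \<rho>_1 \<rho>_n and y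
  = \<rho>_n. For i = n it is the torus relation x^n = y^(n+1).\<close>

lemma (in group) power_of_rho:
  assumes "\<And>i. i \<in> {1..n} \<Longrightarrow> \<rho> i \<in> carrier G"
    and "\<And>i. \<lbrakk>1 \<le> i; i < n\<rbrakk> \<Longrightarrow> \<rho> 1 \<otimes> (\<rho> n \<otimes> \<rho> i) = \<rho> (Suc i) \<otimes> \<rho> n"
    and "i \<in> {1..n}"
  shows "(\<rho> 1 \<otimes> \<rho> n) [^] i = \<rho> i \<otimes> \<rho> n [^] i"
  using assms(3)
proof (induction i)
  case (Suc i)
  have cl: "\<rho> 1 \<in> carrier G" "\<rho> n \<in> carrier G" "\<rho> (Suc i) \<in> carrier G"
    using assms(1) Suc.prems by auto
  show ?case
  proof (cases "i = 0")
    case True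
    then show ?thesis using cl by simp
  next
    case False
    then have i: "\<rho> i \<in> carrier G" "i \<in> {1..n}" using assms(1) Suc.prems by auto
    have "(\<rho> 1 \<otimes> \<rho> n) [^] Suc i = \<rho> 1 \<otimes> \<rho> n \<otimes> (\<rho> i \<otimes> \<rho> n [^] i)"
      using nat_pow_Suc2[of "\<rho> 1 \<otimes> \<rho> n" i] cl Suc.IH[OF i(2)] by (simp del: nat_pow_Suc)
    also have "\<dots> = \<rho> 1 \<otimes> (\<rho> n \<otimes> \<rho> i) \<otimes> \<rho> n [^] i" using cl i by (simp add: m_assoc)
    also have "\<dots> = \<rho> (Suc i) \<otimes> \<rho> n \<otimes> \<rho> n [^] i"
      using assms(2)[of i] False Suc.prems by simp
    also have "\<dots> = \<rho> (Suc i) \<otimes> \<rho> n [^] Suc i"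
      using nat_pow_Suc2[of "\<rho> n" i] cl by (simp add: m_assoc del: nat_pow_Suc)
    finally show ?thesis .
  qed
qed simp

lemma Gn_iso_torus_group:
  assumes "n \<ge> 1"
  shows "Gn n \<cong> torus_group n (n + 1)"
proof -
  define T where "T = torus_group n (n + 1)"
  define R :: "(nat list \<times> nat list) set" where "R = {(replicate n 0, replicate (n + 1) 1)}"
  have T: "T = pres_group {0, 1} R" by (simp add: T_def torus_group_def R_def)
  interpret G: group "Gn n" by (simp add: Gn_def group_pres_group)
  interpret T: group T by (simp add: T group_pres_group)
  define \<rho> where "\<rho> i = gclass {1..n} (Mn_rels n) [(i, True)]" for i
  define x where "x = gclass {0, 1} R [(0, True)]"
  define y where "y = gclass {0, 1} R [(1, True)]"
  have \<rho> [simp]: "\<rho> i \<in> carrier (Gn n)" if "i \<in> {1..n}" for i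
    using that by (auto simp: \<rho>_def Gn_def carrier_pres_group)
  have xy [simp]: "x \<in> carrier T" "y \<in> carrier T"
    by (auto simp: x_def y_def T carrier_pres_group)
  have rel_T: "x [^]\<^bsub>T\<^esub> n = y [^]\<^bsub>T\<^esub> Suc n"
  proof -
    have "gstep R (pos_word (replicate n 0)) (pos_word (replicate (n + 1) 1))"
      using gstep.rel[of "replicate n 0" "replicate (n + 1) 1" R "[]" "[]"] by (simp add: R_def)
    then have "gclass {0, 1} R (pos_word (replicate n 0)) = gclass {0, 1} R (pos_word (replicate (n + 1) 1))"
      by (subst gclass_eq_iff) (auto intro!: pos_word_in_lists r_into_equivclp)
    then show ?thesis 
      using gclass_replicate[of 0 "{0, 1}" R n] gclass_replicate[of 1 "{0, 1}" R "n + 1"]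
      by (simp add: x_def y_def T)
  qed
  have rel_G: "\<rho> 1 \<otimes>\<^bsub>Gn n\<^esub> (\<rho> n \<otimes>\<^bsub>Gn n\<^esub> \<rho> i) = \<rho> (Suc i) \<otimes>\<^bsub>Gn n\<^esub> \<rho> n" if "1 \<le> i" "i < n" for i
  proof -
    have "gstep (Mn_rels n) (pos_word [1, n, i]) (pos_word [Suc i, n])"
      using gstep.rel[of "[1, n, i]" "[Suc i, n]" "Mn_rels n" "[]" "[]"] that by (simp add: Mn_rels_iff)
    then show ?thesis
      using that by (auto simp: \<rho>_def Gn_def gclass_mult gclass_eq_iff intro: r_into_equivclp)
  qed
  define f where "f i = x [^]\<^bsub>T\<^esub> i \<otimes>\<^bsub>T\<^esub> inv\<^bsub>T\<^esub> (y [^]\<^bsub>T\<^esub> i)" for i :: nat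
  \<comment> \<open>Letters other than 0 and 1 also get the value \<open>\<rho> n\<close>, which
    keeps the whole range in the carrier.\<close>
  define f' where "f' g = (if g = 0 then \<rho> 1 \<otimes>\<^bsub>Gn n\<^esub> \<rho> n else \<rho> n)" for g :: nat
  have f: "range f \<subseteq> carrier T" by (auto simp: f_def)
  have f': "range f' \<subseteq> carrier (Gn n)" using assms by (auto simp: f'_def)
  have fR: "word_value T f (pos_word p) = word_value T f (pos_word q)" if rel: "(p, q) \<in> Mn_rels n" for p q
  proof -
    obtain i where "p = [1, n, i]" "q = [Suc i, n]" using rel by (auto simp: Mn_rels_iff)
    then show ?thesis
      using T.torus_relation(2)[OF xy rel_T, of i, folded f_def] range_subsetD[OF f] by simp
  qed
  have pow: "(\<rho> 1 \<otimes>\<^bsub>Gn n\<^esub> \<rho> n) [^]\<^bsub>Gn n\<^esub> i = \<rho> i \<otimes>\<^bsub>Gn n\<^esub> \<rho> n [^]\<^bsub>Gn n\<^esub> i"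
    if "i \<in> {1..n}" for i
    using G.power_of_rho[of n \<rho> i] rel_G that by simp
  have f'R: "word_value (Gn n) f' (pos_word p) = word_value (Gn n) f' (pos_word q)" if "(p, q) \<in> R" for p q
  proof -
    have "p = replicate n 0" "q = replicate (n + 1) 1" using that by (auto simp: R_def)
    then show ?thesis
      using pow[of n] assms G.word_value_replicate[OF f', of n 0] G.word_value_replicate[OF f', of "n + 1" 1]
      by (simp add: f'_def G.nat_pow_Suc2 del: G.nat_pow_Suc nat_pow_Suc replicate_Suc)
  qed
  define h where "h = T.lift_hom f"
  define h' where "h' = G.lift_hom f'"
  have h: "h \<in> hom (Gn n) T"
    unfolding h_def Gn_def by (rule T.lift_hom_hom[OF f fR])
  have h': "h' \<in> hom T (Gn n)"
    unfolding h'_def T by (rule G.lift_hom_hom[OF f' f'R])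
  interpret h: group_hom "Gn n" T h using h by unfold_locales
  interpret h': group_hom T "Gn n" h' using h' by unfold_locales
  have h_\<rho>: "h (\<rho> i) = f i" if "i \<in> {1..n}" for i
    using T.lift_hom_gclass[OF f fR, where w = "[(i, True)]" and A = "{1..n}"] that range_subsetD[OF f]
    by (simp add: h_def \<rho>_def)
  have h'_x: "h' x = \<rho> 1 \<otimes>\<^bsub>Gn n\<^esub> \<rho> n" and h'_y: "h' y = \<rho> n"
    using G.lift_hom_gclass[OF f' f'R, where w = "[(0, True)]" and A = "{0, 1}"]
      G.lift_hom_gclass[OF f' f'R, where w = "[(1, True)]" and A = "{0, 1}"] assms
    by (simp_all add: h'_def x_def y_def f'_def)
  have fn: "f n = y"
    unfolding f_def by (rule T.torus_relation(1)[OF xy rel_T])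
  have h'h: "h' (h z) = z" if "z \<in> carrier (Gn n)" for z
  proof -
    \<comment> \<open>The image is (\<rho>_1 \<rho>_n)^i \<rho>_n^-i, which \<open>pow\<close>
      reduces to \<rho>_i.\<close>
    have "(h' \<circ> h) (\<rho> i) = \<rho> i" if "i \<in> {1..n}" for i
      using that assms pow[OF that]
      by (simp add: h_\<rho> f_def h'.hom_nat_pow h'_x h'_y G.m_assoc)
    then show ?thesis
      using hom_fixing_generators[of "h' \<circ> h" "{1..n}" "Mn_rels n" z]
        hom_compose[OF h h'] that by (simp add: \<rho>_def Gn_def o_def)
  qed
  have hh': "h (h' z) = z" if "z \<in> carrier T" for z
  proof -
    \<comment> \<open>The image of \<rho>_1 \<rho>_n is x y^-1 y, because \<rho>_n goes to
      y.\<close>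
    have "h (h' x) = x"
      using assms fn by (simp add: h'_x h_\<rho>) (simp add: f_def T.m_assoc)
    moreover have "h (h' y) = y" using assms by (simp add: h'_y h_\<rho> fn)
    ultimately show ?thesis
      using hom_fixing_generators[of "h \<circ> h'" "{0, 1}" R z]
        hom_compose[OF h' h] that by (auto simp: x_def y_def T o_def)
  qed
  have "bij_betw h (carrier (Gn n)) (carrier T)"
    by (rule bij_betw_byWitness[of _ h']) (auto simp: h'h hh')
  then have "h \<in> iso (Gn n) T" using h by (simp add: iso_def)
  then show ?thesis by (auto simp: is_iso_def T_def)
qed

theorem theorem4p13:
  fixes n :: nat
  assumes "n \<ge> 1"
  shows "garside_monoid (Mn n) (Delta_n n)
    \<and> group (Gn n)
    \<and> canon {1..n} (Mn_rels n) \<in> hom (Mn n) (Gn n)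
    \<and> inj_on (canon {1..n} (Mn_rels n)) (carrier (Mn n))
    \<and> (\<forall>g\<in>carrier (Gn n). \<exists>a\<in>carrier (Mn n). \<exists>b\<in>carrier (Mn n).
          g = canon {1..n} (Mn_rels n) a \<otimes>\<^bsub>Gn n\<^esub> inv\<^bsub>Gn n\<^esub> (canon {1..n} (Mn_rels n) b))
    \<and> Gn n \<cong> torus_group n (n + 1)"
proof -
  interpret torus_normal_forms n using assms by unfold_locales
  interpret atomic_lcm_monoid "Mn n" "(\<lambda>i. elt [i]) ` {1..n}" wt "Delta_n n"
    by (rule atomic_lcm_monoid_Mn)
  show ?thesis
    by (intro conjI ballI garside_monoid group_Gn canon_hom_Gn inj_canon Gn_fraction
        Gn_iso_torus_group[OF assms])
qed

end
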